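(* Let $d\ge1$ and let $(i_1,j_1),\ldots,(i_d,j_d)$ be pairs of real numbers with $0\le i_t,j_t\le1$ and $i_t+j_t=1$ for each $t$. Let $\alpha,\beta\in\mathbb{R}$ and let $\mathcal{L}_{\alpha,\beta}=\{(x,\alpha x+\beta):x\in\mathbb{R}\}$ be the line $y=\alpha x+\beta$. Put $\sigma:=\max\{\min\{i_t,j_t\}:1\le t\le d\}$ and suppose there exists $\epsilon>0$ such that $$\liminf_{q\to\infty} q^{\frac1\sigma-\epsilon}\,\|q\alpha\|>0.$$ Then $\dim\Big(\bigcap_{t=1}^{d}\mathbf{Bad}(i_t,j_t)\cap\mathcal{L}_{\alpha,\beta}\Big)=1$, where $\dim$ denotes Hausdorff dimension.
   Context: For real numbers $i,j$ with $0\le i,j\le1$ and $i+j=1$, $\mathbf{Bad}(i,j)$ is the set of points $(x,y)\in\mathbb{R}^2$ for which there exists a constant $c(x,y)>0$ such that $\max\{\|qx\|^{1/i},\|qy\|^{1/j}\}>c(x,y)\,q^{-1}$ for all $q\in\mathbb{N}$. Here $\|\cdot\|$ denotes distance to the nearest integer, and by convention $z^{1/0}:=0$. If $\sigma=0$, the hypothesis is read with $1/\sigma=+\infty$ (the theorem is only meaningful for $\sigma>0$). *)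

theory Defs
  imports "HOL-Analysis.Analysis"
begin

definition nint_dist :: "real \<Rightarrow> real" where
  "nint_dist z = \<bar>z - of_int (round z)\<bar>"

text \<open>z^(1/i) with the convention z^(1/0) = 0 (z is always >= 0 here).\<close>
definition pow_inv :: "real \<Rightarrow> real \<Rightarrow> real" where
  "pow_inv z i = (if i = 0 then 0 else z powr (1 / i))"

definition Bad :: "real \<Rightarrow> real \<Rightarrow> (real \<times> real) set" where
  "Bad i j = {(x, y). \<exists>c>0. \<forall>q::nat. q \<ge> 1 \<longrightarrow>
      max (pow_inv (nint_dist (real q * x)) i) (pow_inv (nint_dist (real q * y)) j) > c / real q}"

definition line :: "real \<Rightarrow> real \<Rightarrow> (real \<times> real) set" where
  "line \<alpha> \<beta> = {(x, \<alpha> * x + \<beta>) | x. True}"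

definition hausdorff_pre :: "real \<Rightarrow> real \<Rightarrow> 'a::metric_space set \<Rightarrow> ennreal" where
  "hausdorff_pre s \<delta> S =
     (INF C \<in> {C :: nat \<Rightarrow> 'a set. S \<subseteq> (\<Union>n. C n) \<and>
                 (\<forall>n. bounded (C n) \<and> diameter (C n) \<le> \<delta>)}.
        (\<Sum>n. ennreal (diameter (C n) powr s)))"

definition hausdorff_measure :: "real \<Rightarrow> 'a::metric_space set \<Rightarrow> ennreal" where
  "hausdorff_measure s S = (SUP \<delta> \<in> {0<..}. hausdorff_pre s \<delta> S)"

definition hausdorff_dim :: "'a::metric_space set \<Rightarrow> real" where
  "hausdorff_dim S = Inf {s. s > 0 \<and> hausdorff_measure s S = 0}"

end

theory Submission
  imports Defs
begin

text \<open>The lower bound for the dimension is a potential game. Suppose that families of obstacles on the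
  real line are such that, inside every interval of length \<open>R\<^sup>-\<^sup>n\<close> avoiding the obstacles that are at least as
  long, the obstacles of level \<open>n\<close> are covered by intervals of relative lengths \<open>w l\<close> with
  \<open>\<Sum> (w l)\<^sup>\<gamma>\<close> small, \<open>\<gamma> < 1\<close>. Passing to the \<open>R\<close>-adic child with smallest potential
  \<open>\<Sum> (|I|/|J|)\<^sup>\<gamma>\<close> produces a point outside all obstacles. If the set in question had zero
  \<open>s\<close>-dimensional measure for some \<open>s < 1\<close>, the members of a cover with small \<open>\<Sum> diam\<^sup>s\<close> could be added as
  obstacles, and a point of the set outside the cover would result.

  It remains to handle one pair \<open>(i, j)\<close>. Rational points of height about \<open>R\<^sup>m\<close> near a
  short interval are collinear by the simplex lemma, so the intervals around them are covered by one interval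
  coming from a rational line, unless this line is nearly parallel to \<open>y = \<alpha>x + \<beta>\<close>. Nearly parallel
  lines are therefore obstacles of their own, announced earlier. Two independent ones near the same interval would
  meet in a rational point of much smaller height, whose neighbourhood has already been avoided; so there is
  at most one of them for each degree of parallelism. The Diophantine condition on
  \<open>\<alpha>\<close> bounds that degree, so that no such obstacle is announced before the start of the game.\<close>

section \<open>The potential game\<close>

text \<open>\<open>X n l\<close> is an obstacle announced on intervals of length \<open>R\<^sup>-\<^sup>n\<close>. It only has to be coverable by an
  interval of relative length \<open>w l\<close> on those intervals that already avoid every obstacle, of whatever
  level \<open>n'\<close>, whose covering interval would be at least as long as the current one.\<close>

definition strategy :: "real \<Rightarrow> real \<Rightarrow> real \<Rightarrow> (nat \<Rightarrow> nat \<Rightarrow> real set) \<Rightarrow> (nat \<Rightarrow> real) \<Rightarrow> bool" where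
  "strategy R \<gamma> \<eta> X w \<longleftrightarrow>
     (\<forall>l. 0 < w l) \<and> summable (\<lambda>l. w l powr \<gamma>) \<and> (\<Sum>l. w l powr \<gamma>) \<le> \<eta> \<and>
     (\<forall>n u. (\<forall>n' l. R powr - real n \<le> w l * R powr - real n' \<longrightarrow> {u..u + R powr - real n} \<inter> X n' l = {}) \<longrightarrow>
        (\<forall>l. \<exists>v. X n l \<inter> {u..u + R powr - real n} \<subseteq> {v..v + w l * R powr - real n}))"

text \<open>The budget \<open>\<eta>\<close> is a parameter because budgets add up under unions;
  \<open>R\<close> and \<open>\<gamma>\<close> are shared by all families that are played against at
  once.\<close>

definition avoidable :: "real \<Rightarrow> real \<Rightarrow> real \<Rightarrow> real set \<Rightarrow> bool" where
  "avoidable R \<gamma> \<eta> S \<longleftrightarrow> (\<exists>X w. strategy R \<gamma> \<eta> X w \<and> S \<subseteq> (\<Union>n l. X n l))"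

lemma card_nat_in_interval:
  fixes p z :: real
  assumes "z \<ge> 0" "finite T" and "\<And>a::nat. a \<in> T \<Longrightarrow> p \<le> real a \<and> real a \<le> p + z"
  shows "real (card T) \<le> z + 1"
proof -
  have "int ` T \<subseteq> {\<lceil>p\<rceil>..\<lfloor>p + z\<rfloor>}"
    using assms(3) by (auto simp: ceiling_le_iff le_floor_iff)
  then have "card (int ` T) \<le> card {\<lceil>p\<rceil>..\<lfloor>p + z\<rfloor>}"
    by (intro card_mono) auto
  then have "card T \<le> nat (\<lfloor>p + z\<rfloor> - \<lceil>p\<rceil> + 1)"
    by (simp add: card_image)
  moreover have "real (nat (\<lfloor>p + z\<rfloor> - \<lceil>p\<rceil> + 1)) \<le> z + 1"
    using assms(1) by linarith
  ultimately show ?thesis by linarith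
qed

text \<open>Contribution of one covering interval to the potential of \<open>{u..u + h}\<close>. The
  argument \<open>y\<close> stands for the ratio \<open>len / h\<close>.\<close>

definition pot :: "real \<Rightarrow> real \<Rightarrow> real \<Rightarrow> real \<Rightarrow> real \<Rightarrow> real \<Rightarrow> real" where
  "pot \<gamma> v y u h len = (if {v..v + len} \<inter> {u..u + h} = {} then 0 else y powr \<gamma>)"

lemma pot_nonneg: "0 \<le> pot \<gamma> v y u h len"
  by (simp add: pot_def)

lemma pot_le: "pot \<gamma> v y u h len \<le> y powr \<gamma>"
  by (simp add: pot_def)

text \<open>A contribution of at most \<open>1 / (4 * R)\<close> forces the obstacle to be no longer
  than a quarter of a child, so it meets very few of the \<open>R\<close> children. On those the
  contribution grows by \<open>R powr \<gamma>\<close>, which is small against \<open>R\<close> as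
  \<open>\<gamma> < 1\<close>; hence the average over all children is at most half the old
  value.\<close>

lemma sum_pot_children_le:
  fixes R :: nat and \<gamma> v u h y :: real
  assumes \<gamma>: "0 < \<gamma>" "\<gamma> < 1" and R: "R \<ge> 1" "9/4 * real R powr \<gamma> \<le> real R / 2"
    and h: "h > 0" and y: "y > 0" "pot \<gamma> v y u h (y * h) \<le> 1 / (4 * real R)"
  shows "(\<Sum>a<R. pot \<gamma> v (real R * y) (u + real a * (h / real R)) (h / real R) (y * h))
           \<le> real R / 2 * pot \<gamma> v y u h (y * h)"
proof (cases "{v..v + y * h} \<inter> {u..u + h} = {}")
  case True
  have "pot \<gamma> v (real R * y) (u + real a * (h / real R)) (h / real R) (y * h) = 0" if "a < R" for a
  proof -
    have "real a * (h / real R) \<ge> 0" using h by simp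
    moreover have "(real a + 1) * (h / real R) \<le> real R * (h / real R)"
      using that h by (intro mult_right_mono) auto
    then have "real a * (h / real R) + h / real R \<le> h"
      using R h by (simp add: field_simps)
    ultimately have "{u + real a * (h / real R)..u + real a * (h / real R) + h / real R} \<subseteq> {u..u + h}"
      by auto
    then show ?thesis using True unfolding pot_def by (smt (verit) disjoint_iff subset_eq)
  qed
  then show ?thesis by (simp add: pot_nonneg R)
next
  case False
  have Rp: "real R > 0" using R by simp
  have yg: "y powr \<gamma> \<le> 1 / (4 * real R)" and pe: "pot \<gamma> v y u h (y * h) = y powr \<gamma>"
    using y(2) False by (auto simp: pot_def)
  have "1 / (4 * real R) < 1" using R by (simp add: divide_less_eq)
  have "y < 1"
  proof (rule ccontr)
    assume "\<not> y < 1"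
    then have "1 \<le> y powr \<gamma>" using \<gamma> by (simp add: ge_one_powr_ge_zero)
    with yg \<open>1 / (4 * real R) < 1\<close> show False by linarith
  qed
  then have "y powr 1 \<le> y powr \<gamma>" using \<gamma> y(1) by (intro powr_mono') auto
  then have "y \<le> 1 / (4 * real R)" using y(1) yg by simp
  then have Ry: "real R * y \<le> 1/4" using Rp by (simp add: field_simps)
  define T where "T = {a. a < R \<and> {v..v + y * h} \<inter> {u + real a * (h / real R)..u + real a * (h / real R) + h / real R} \<noteq> {}}"
  have fin: "finite T" unfolding T_def by simp
  \<comment> \<open>In units of a child, the left ends of the children met range over a window of
    length \<open>R * y + 1\<close>: the obstacle's length plus one child.\<close>
  have "real (card T) \<le> (real R * y + 1) + 1"
  proof (rule card_nat_in_interval[OF _ fin, where p = "(v - u) * (real R / h) - 1"])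
    show "0 \<le> real R * y + 1" using y by simp
    fix a assume "a \<in> T"
    then obtain x where "x \<in> {v..v + y * h} \<inter> {u + real a * (h / real R)..u + real a * (h / real R) + h / real R}"
      unfolding T_def by blast
    then have x: "v \<le> x" "x \<le> v + y * h" "u + real a * (h / real R) \<le> x"
       "x \<le> u + real a * (h / real R) + h / real R" by auto
    have 1: "(v - u) \<le> (real a + 1) * (h / real R)" using x by (simp add: distrib_right add_divide_distrib)
    have "(v - u) * (real R / h) \<le> (real a + 1) * (h / real R) * (real R / h)"
      by (rule mult_right_mono[OF 1]) (use h in auto)
    then have A: "(v - u) * (real R / h) \<le> real a + 1" using h Rp by simp
    have 2: "real a * (h / real R) \<le> v - u + y * h" using x by linarith
    have "real a * (h / real R) * (real R / h) \<le> (v - u + y * h) * (real R / h)"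
      by (rule mult_right_mono[OF 2]) (use h in auto)
    then have B: "real a \<le> (v - u) * (real R / h) + y * real R" using h Rp by (simp add: distrib_right add_divide_distrib)
    show "(v - u) * (real R / h) - 1 \<le> real a \<and> real a \<le> (v - u) * (real R / h) - 1 + (real R * y + 1)"
      using A B by (simp add: mult.commute)
  qed
  then have cT: "real (card T) \<le> 9/4" using Ry by linarith
  have "(\<Sum>a<R. pot \<gamma> v (real R * y) (u + real a * (h / real R)) (h / real R) (y * h))
      = (\<Sum>a\<in>T. (real R * y) powr \<gamma>)"
    unfolding pot_def T_def by (intro sum.mono_neutral_cong_right) auto
  also have "\<dots> = real (card T) * (real R * y) powr \<gamma>" by simp
  also have "\<dots> \<le> 9/4 * (real R * y) powr \<gamma>" using cT by (intro mult_right_mono) auto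
  also have "\<dots> = (9/4 * real R powr \<gamma>) * y powr \<gamma>" using y by (simp add: powr_mult)
  also have "\<dots> \<le> (real R / 2) * y powr \<gamma>" using R by (intro mult_right_mono) auto
  finally show ?thesis using pe by simp
qed

text \<open>The budget is balanced: the best child brings the potential from
  \<open>1 / (4 * R)\<close> down to \<open>1 / (8 * R)\<close>, and the obstacles newly announced
  there add at most \<open>1 / (8 * R)\<close>.\<close>

lemma avoidable_point:
  fixes R :: nat
  assumes \<gamma>: "0 < \<gamma>" "\<gamma> < 1" and R: "R \<ge> 2" "9/4 * real R powr \<gamma> \<le> real R / 2"
    and av: "avoidable (real R) \<gamma> (1 / (8 * real R)) S"
  shows "\<exists>x. 0 \<le> x \<and> x \<le> 1 \<and> x \<notin> S"
proof -
  from av obtain X w where st: "strategy (real R) \<gamma> (1 / (8 * real R)) X w" and SX: "S \<subseteq> (\<Union>n l. X n l)"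
    unfolding avoidable_def by blast
  define E where "E n = real R powr - real n" for n :: nat
  have Rp: "real R > 0" "real R \<ge> 2" using R by auto
  then have Epow: "E n = (1 / real R) ^ n" for n
    by (simp add: E_def powr_minus powr_realpow power_one_over inverse_eq_divide)
  have E0: "E 0 = 1" and ESuc: "\<And>n. E (Suc n) = E n / real R" and Epos: "\<And>n. E n > 0"
    using Rp by (auto simp: Epow)
  have w: "\<And>l. 0 < w l" and sw: "summable (\<lambda>l. w l powr \<gamma>)" and lew: "(\<Sum>l. w l powr \<gamma>) \<le> 1 / (8 * real R)"
    using st by (auto simp: strategy_def)
  have step: "\<exists>v. X n l \<inter> {u..u + E n} \<subseteq> {v..v + w l * E n}"
    if "\<And>n' l. E n \<le> w l * E n' \<Longrightarrow> {u..u + E n} \<inter> X n' l = {}" for n u l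
    using st that unfolding strategy_def E_def by blast
  have small: "1 / (8 * real R) < 1" using Rp by (simp add: divide_less_eq)
  have w1: "w l < 1" for l
  proof (rule ccontr)
    assume "\<not> w l < 1"
    then have "1 \<le> w l powr \<gamma>" using \<gamma> by (simp add: ge_one_powr_ge_zero)
    also have "\<dots> \<le> (\<Sum>l. w l powr \<gamma>)" using sum_le_suminf[OF sw, of "{l}"] by simp
    finally show False using lew small by linarith
  qed
  \<comment> \<open>\<open>V n' l\<close> is the left end of the interval chosen to cover
    \<open>X n' l\<close>; \<open>f\<close> is its contribution to the interval of length
    \<open>E n\<close> at \<open>u\<close>, and \<open>Phi\<close> collects the levels below
    \<open>m\<close>.\<close>
  define f where "f n u V n' l = pot \<gamma> (V n' l) (w l * E n' / E n) u (E n) (w l * E n')"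
    for n n' l :: nat and u :: real and V :: "nat \<Rightarrow> nat \<Rightarrow> real"
  have fn: "0 \<le> f n u V n' l" for n u V n' l by (simp add: f_def pot_nonneg)
  have fle: "f n u V n' l \<le> (E n' / E n) powr \<gamma> * w l powr \<gamma>" for n u V n' l
  proof -
    have "f n u V n' l \<le> (w l * E n' / E n) powr \<gamma>" by (simp add: f_def pot_le)
    also have "\<dots> = (E n' / E n) powr \<gamma> * w l powr \<gamma>"
      using w[of l] Epos[of n] Epos[of n'] by (simp add: powr_mult powr_divide)
    finally show ?thesis .
  qed
  have fs: "summable (f n u V n')" for n u V n'
    by (rule summable_comparison_test'[OF summable_mult[OF sw], where N = 0]) (use fn fle in auto)
  define Phi where "Phi m n u V = (\<Sum>n'<m. \<Sum>l. f n u V n' l)" for m n u V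
  have fPhi: "f n u V n' l \<le> Phi m n u V" if "n' < m" for m n u V n' l
  proof -
    have "f n u V n' l \<le> (\<Sum>l. f n u V n' l)" using sum_le_suminf[OF fs, of "{l}"] fn by simp
    also have "\<dots> \<le> Phi m n u V" unfolding Phi_def
      by (rule member_le_sum[of n' "{..<m}" "\<lambda>n'. \<Sum>l. f n u V n' l"]) (use that in \<open>auto intro!: suminf_nonneg fn fs\<close>)
    finally show ?thesis .
  qed
  have child: "\<exists>a<R. Phi m (Suc n) (u + real a * (E n / real R)) V \<le> 1 / (8 * real R)"
    if P: "Phi m n u V \<le> 1 / (4 * real R)" for m n u V
  proof -
    let ?u = "\<lambda>a. u + real a * (E n / real R)"
    have "(\<Sum>a<R. Phi m (Suc n) (?u a) V) = (\<Sum>n'<m. \<Sum>a<R. \<Sum>l. f (Suc n) (?u a) V n' l)"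
      unfolding Phi_def by (rule sum.swap)
    also have "\<dots> = (\<Sum>n'<m. \<Sum>l. \<Sum>a<R. f (Suc n) (?u a) V n' l)"
      by (intro sum.cong suminf_sum[symmetric] fs) auto
    also have "\<dots> \<le> (\<Sum>n'<m. \<Sum>l. real R / 2 * f n u V n' l)"
    proof (intro sum_mono suminf_le summable_sum summable_mult fs)
      fix n' l assume n': "n' \<in> {..<m}"
      have "(\<Sum>a<R. pot \<gamma> (V n' l) (real R * (w l * E n' / E n)) (u + real a * (E n / real R)) (E n / real R) (w l * E n' / E n * E n))
           \<le> real R / 2 * pot \<gamma> (V n' l) (w l * E n' / E n) u (E n) (w l * E n' / E n * E n)"
      proof (rule sum_pot_children_le[OF \<gamma> _ R(2)])
        have "f n u V n' l \<le> 1 / (4 * real R)" using fPhi[of n' m n u V l] n' P by simp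
        then show "pot \<gamma> (V n' l) (w l * E n' / E n) u (E n) (w l * E n' / E n * E n) \<le> 1 / (4 * real R)"
          using Epos[of n] by (simp add: f_def)
      qed (use R Epos[of n] Epos[of n'] w in auto)
      moreover have "w l * E n' / E n * E n = w l * E n'" using Epos[of n] by simp
      moreover have "real R * (w l * E n' / E n) = w l * E n' / (E n / real R)" by simp
      ultimately show "(\<Sum>a<R. f (Suc n) (?u a) V n' l) \<le> real R / 2 * f n u V n' l"
        unfolding f_def ESuc by (metis (no_types, lifting) sum.cong)
    qed
    also have "\<dots> = real R / 2 * Phi m n u V"
      unfolding Phi_def by (simp only: suminf_mult[OF fs] sum_distrib_left)
    also have "\<dots> \<le> real R / 2 * (1 / (4 * real R))" using P Rp by (intro mult_left_mono) auto
    also have "\<dots> = (\<Sum>a<R. 1 / (8 * real R))" using Rp by simp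
    finally have le: "(\<Sum>a<R. Phi m (Suc n) (?u a) V) \<le> (\<Sum>a<R. 1 / (8 * real R))" .
    show ?thesis
    \<comment> \<open>The values on the \<open>R\<close> children add up to at most
      \<open>1 / 8\<close>, so not all of them can exceed \<open>1 / (8 * R)\<close>.\<close>
    proof (rule ccontr)
      assume "\<not> ?thesis"
      then have "(\<Sum>a<R. 1 / (8 * real R)) < (\<Sum>a<R. Phi m (Suc n) (?u a) V)"
        using R by (intro sum_strict_mono) (auto simp: not_le lessThan_empty_iff)
      with le show False by linarith
    qed
  qed
  define P where "P n s \<longleftrightarrow> (case s of (u, V) \<Rightarrow> 0 \<le> u \<and> u + E n \<le> 1 \<and> Phi (Suc n) n u V \<le> 1 / (4 * real R) \<and>
      (\<forall>n'\<le>n. \<forall>l. X n' l \<inter> {u..u + E n} \<subseteq> {V n' l..V n' l + w l * E n'}))" for n s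
  have extend: "\<exists>V'. (\<forall>n'<n. V' n' = V n') \<and> P n (u, V')"
    if u: "0 \<le> u" "u + E n \<le> 1" and ph: "Phi n n u V \<le> 1 / (8 * real R)"
      and old: "\<And>n' l. n' < n \<Longrightarrow> X n' l \<inter> {u..u + E n} \<subseteq> {V n' l..V n' l + w l * E n'}" for n u V
  proof -
    \<comment> \<open>The hypothesis under which the strategy supplies covers at level
      \<open>n\<close>. An older obstacle at least as long as the interval would contribute 1 or
      more, so its cover misses the interval; at level \<open>n\<close> or later every cover is
      shorter because \<open>w l < 1\<close>.\<close>
    have "{u..u + E n} \<inter> X n' l = {}" if le: "E n \<le> w l * E n'" for n' l
    proof (cases "n' < n")
      case True
      have "1 \<le> w l * E n' / E n" using le Epos[of n] by simp
      then have "1 \<le> (w l * E n' / E n) powr \<gamma>" using \<gamma> by (simp add: ge_one_powr_ge_zero)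
      moreover have "f n u V n' l < 1" using fPhi[OF True, of n u V l] ph small by linarith
      ultimately have "{V n' l..V n' l + w l * E n'} \<inter> {u..u + E n} = {}"
        unfolding f_def pot_def by (auto split: if_splits)
      with old[OF True, of l] show ?thesis by blast
    next
      case False
      have "w l * E n' < 1 * E n'" using w1 Epos by (intro mult_strict_right_mono) auto
      also have "\<dots> \<le> E n" unfolding E_def using False R by (simp)
      finally show ?thesis using le by simp
    qed
    then obtain v where v: "\<And>l. X n l \<inter> {u..u + E n} \<subseteq> {v l..v l + w l * E n}"
      using step[of n u] by metis
    define V' where "V' = V(n := v)"
    have "Phi (Suc n) n u V' = Phi n n u V + (\<Sum>l. f n u V' n l)"
    proof -
      have "(\<Sum>n'<n. \<Sum>l. f n u V' n' l) = (\<Sum>n'<n. \<Sum>l. f n u V n' l)"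
        by (intro sum.cong refl suminf_cong) (simp add: f_def V'_def)
      then show ?thesis by (simp add: Phi_def)
    qed
    also have "(\<Sum>l. f n u V' n l) \<le> (\<Sum>l. w l powr \<gamma>)"
      by (intro suminf_le fs sw) (use fle[of n u V' n] Epos[of n] in simp)
    finally have "Phi (Suc n) n u V' \<le> 1 / (4 * real R)" using ph lew by (simp add: field_simps)
    then have "P n (u, V')" using u old v by (auto simp: P_def V'_def le_less)
    moreover have "\<forall>n'<n. V' n' = V n'" by (simp add: V'_def)
    ultimately show ?thesis by blast
  qed
  define Q where "Q n s s' \<longleftrightarrow> (case s of (u, V) \<Rightarrow> case s' of (u', V') \<Rightarrow>
      u \<le> u' \<and> u' + E (Suc n) \<le> u + E n \<and> (\<forall>n'\<le>n. V' n' = V n'))" for n and s s' :: "real \<times> (nat \<Rightarrow> nat \<Rightarrow> real)"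
  \<comment> \<open>Before the first move there are no older levels: the potential is an empty sum
    and the value \<open>undefined\<close> is never inspected.\<close>
  have "\<exists>V'. (\<forall>n'<0. V' n' = undefined n') \<and> P 0 (0, V')"
    by (rule extend) (use E0 Rp in \<open>auto simp: Phi_def\<close>)
  then have init: "\<exists>s. P 0 s" by blast
  have next_state: "\<exists>s'. P (Suc n) s' \<and> Q n s s'" if "P n s" for n s
  proof -
    obtain u V where s: "s = (u, V)" by force
    have u: "0 \<le> u" "u + E n \<le> 1" and ph: "Phi (Suc n) n u V \<le> 1 / (4 * real R)"
      and old: "\<And>n' l. n' \<le> n \<Longrightarrow> X n' l \<inter> {u..u + E n} \<subseteq> {V n' l..V n' l + w l * E n'}"
      using that by (auto simp: P_def s)
    from child[OF ph] obtain a where a: "a < R" and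
      ph': "Phi (Suc n) (Suc n) (u + real a * (E n / real R)) V \<le> 1 / (8 * real R)" by blast
    define u' where "u' = u + real a * (E n / real R)"
    have "(real a + 1) * (E n / real R) \<le> real R * (E n / real R)"
      using a Epos[of n] by (intro mult_right_mono) auto
    then have sub: "u \<le> u'" "u' + E (Suc n) \<le> u + E n"
      using Rp Epos[of n] by (auto simp: u'_def ESuc distrib_right add_divide_distrib)
    have "\<exists>V'. (\<forall>n'<Suc n. V' n' = V n') \<and> P (Suc n) (u', V')"
    proof (rule extend)
      show "X n' l \<inter> {u'..u' + E (Suc n)} \<subseteq> {V n' l..V n' l + w l * E n'}" if "n' < Suc n" for n' l
      proof -
        have "{u'..u' + E (Suc n)} \<subseteq> {u..u + E n}" using sub by auto
        with old[of n' l] that show ?thesis by (auto simp: less_Suc_eq_le)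
      qed
    qed (use u sub ph' in \<open>auto simp: u'_def\<close>)
    then obtain V' where "\<forall>n'<Suc n. V' n' = V n'" "P (Suc n) (u', V')" by blast
    then show ?thesis using sub by (intro exI[of _ "(u', V')"]) (auto simp: Q_def s less_Suc_eq_le)
  qed
  have "\<exists>s. \<forall>n. P n (s n) \<and> Q n (s n) (s (Suc n))"
    by (rule dependent_nat_choice) (fact init, fact next_state)
  then obtain s where sP: "\<And>n. P n (s n)" and sQ: "\<And>n. Q n (s n) (s (Suc n))" by blast
  define u V where "u n = fst (s n)" and "V n = snd (s n)" for n
  have PV: "P n (u n, V n)" and QV: "Q n (u n, V n) (u (Suc n), V (Suc n))" for n
    using sP[of n] sQ[of n] by (auto simp: u_def V_def)
  have inc: "incseq u" by (rule incseq_SucI) (use QV in \<open>auto simp: Q_def\<close>)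
  have dec: "decseq (\<lambda>n. u n + E n)" by (rule decseq_SucI) (use QV in \<open>auto simp: Q_def\<close>)
  define x where "x = (SUP n. u n)"
  have bdd: "bdd_above (range u)"
  proof (rule bdd_aboveI[of _ 1])
    fix y assume "y \<in> range u"
    then obtain n where "y = u n" by blast
    moreover have "u n + E n \<le> 1" using PV[of n] by (simp add: P_def)
    ultimately show "y \<le> 1" using Epos[of n] by linarith
  qed
  have xu: "u n \<le> x" for n unfolding x_def by (rule cSUP_upper[OF _ bdd]) simp
  have xv: "x \<le> u n + E n" for n unfolding x_def
  proof (rule cSUP_least)
    fix m
    have "u m \<le> u (max m n)" using inc by (simp add: incseqD)
    also have "\<dots> \<le> u (max m n) + E (max m n)" using Epos[of "max m n"] by simp
    also have "\<dots> \<le> u n + E n" using decseqD[OF dec, of n "max m n"] by simp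
    finally show "u m \<le> u n + E n" .
  qed simp
  have "x \<notin> X n l" for n l
  proof
    assume xX: "x \<in> X n l"
    have "(\<lambda>n. E n) \<longlonglongrightarrow> 0"
    proof -
      have "(\<lambda>n. (1 / real R) ^ n) \<longlonglongrightarrow> 0" using Rp by (intro LIMSEQ_power_zero) auto
      then show ?thesis by (simp add: Epow)
    qed
    then have "eventually (\<lambda>m. E m < w l * E n) sequentially"
      by (rule order_tendstoD) (use w Epos in auto)
    then have "eventually (\<lambda>m. E m < w l * E n \<and> n \<le> m) sequentially"
      using eventually_ge_at_top by (rule eventually_conj)
    \<comment> \<open>At stage \<open>m\<close> the cover of \<open>X n l\<close> is longer than the
      interval and shares the point \<open>x\<close> with it, so it alone contributes at least 1,
      against the invariant.\<close>
    then obtain m where m: "E m < w l * E n" "n \<le> m" using eventually_happens by fastforce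
    have ph: "Phi (Suc m) m (u m) (V m) \<le> 1 / (4 * real R)"
      and "X n l \<inter> {u m..u m + E m} \<subseteq> {V m n l..V m n l + w l * E n}"
      using PV[of m] m by (auto simp: P_def)
    then have "x \<in> {V m n l..V m n l + w l * E n} \<inter> {u m..u m + E m}" using xX xu xv by auto
    then have "f m (u m) (V m) n l = (w l * E n / E m) powr \<gamma>" unfolding f_def pot_def by auto
    moreover have "1 \<le> w l * E n / E m" using m Epos[of m] by simp
    then have "1 \<le> (w l * E n / E m) powr \<gamma>" using \<gamma> by (simp add: ge_one_powr_ge_zero)
    ultimately have "1 \<le> 1 / (4 * real R)"
      using fPhi[of n "Suc m" m "u m" "V m" l] m ph by simp
    then show False using Rp by (simp add: le_divide_eq)
  qed
  moreover have "0 \<le> x" "x \<le> 1" using PV[of 0] xu[of 0] xv[of 0] by (auto simp: P_def)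
  ultimately show ?thesis using SX by blast
qed

text \<open>The two families are interleaved by parity of the index. An interval avoiding the long
  obstacles of the merged family avoids those of each, so both strategies apply side by side and
  their costs add.\<close>

lemma avoidable_Un:
  assumes "avoidable R \<gamma> \<eta>1 S1" "avoidable R \<gamma> \<eta>2 S2"
  shows "avoidable R \<gamma> (\<eta>1 + \<eta>2) (S1 \<union> S2)"
proof -
  obtain X1 w1 where 1: "strategy R \<gamma> \<eta>1 X1 w1" "S1 \<subseteq> (\<Union>n l. X1 n l)"
    using assms(1) by (auto simp: avoidable_def)
  obtain X2 w2 where 2: "strategy R \<gamma> \<eta>2 X2 w2" "S2 \<subseteq> (\<Union>n l. X2 n l)"
    using assms(2) by (auto simp: avoidable_def)
  define X where "X n l = (if even l then X1 n (l div 2) else X2 n ((l - 1) div 2))" for n l :: nat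
  define w where "w l = (if even l then w1 (l div 2) else w2 ((l - 1) div 2))" for l :: nat
  have ev: "X n (2 * l) = X1 n l" "w (2 * l) = w1 l" "X n (Suc (2 * l)) = X2 n l" "w (Suc (2 * l)) = w2 l" for n l
    by (auto simp: X_def w_def)
  have "(\<lambda>l. w1 l powr \<gamma>) sums (\<Sum>l. w1 l powr \<gamma>)" "(\<lambda>l. w2 l powr \<gamma>) sums (\<Sum>l. w2 l powr \<gamma>)"
    using 1 2 by (auto simp: strategy_def)
  from sums_if[OF this(2,1)] have sm: "(\<lambda>l. w l powr \<gamma>) sums ((\<Sum>l. w2 l powr \<gamma>) + (\<Sum>l. w1 l powr \<gamma>))"
    by (simp add: w_def if_distrib[of "\<lambda>x. x powr \<gamma>"] cong: if_cong)
  have "strategy R \<gamma> (\<eta>1 + \<eta>2) X w"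
    unfolding strategy_def
  proof (intro conjI allI impI)
    fix l show "0 < w l" using 1 2 by (auto simp: w_def strategy_def)
  next
    show "summable (\<lambda>l. w l powr \<gamma>)" using sm by (rule sums_summable)
    show "(\<Sum>l. w l powr \<gamma>) \<le> \<eta>1 + \<eta>2" using sums_unique[OF sm] 1 2 by (auto simp: strategy_def)
  next
    fix n u l
    let ?J = "{u..u + R powr - real n}"
    assume *: "\<forall>n' l. R powr - real n \<le> w l * R powr - real n' \<longrightarrow> ?J \<inter> X n' l = {}"
    have "\<forall>n' l. R powr - real n \<le> w1 l * R powr - real n' \<longrightarrow> ?J \<inter> X1 n' l = {}" using * ev by metis
    with 1 have J1: "\<exists>v. X1 n l \<inter> ?J \<subseteq> {v..v + w1 l * R powr - real n}" for l
      unfolding strategy_def by blast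
    have "\<forall>n' l. R powr - real n \<le> w2 l * R powr - real n' \<longrightarrow> ?J \<inter> X2 n' l = {}" using * ev by metis
    with 2 have J2: "\<exists>v. X2 n l \<inter> ?J \<subseteq> {v..v + w2 l * R powr - real n}" for l
      unfolding strategy_def by blast
    show "\<exists>v. X n l \<inter> ?J \<subseteq> {v..v + w l * R powr - real n}"
      using J1 J2 by (auto simp: X_def w_def)
  qed
  moreover have "S1 \<union> S2 \<subseteq> (\<Union>n l. X n l)"
  proof
    fix x assume "x \<in> S1 \<union> S2"
    then have "(\<exists>n l. x \<in> X1 n l) \<or> (\<exists>n l. x \<in> X2 n l)" using 1 2 by blast
    then have "\<exists>n l. x \<in> X n l" by (metis ev(1,3))
    then show "x \<in> (\<Union>n l. X n l)" by blast
  qed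
  ultimately show ?thesis by (auto simp: avoidable_def)
qed

lemma avoidable_UN:
  assumes "finite T" "T \<noteq> {}" "\<And>t. t \<in> T \<Longrightarrow> avoidable R \<gamma> \<eta> (S t)"
  shows "avoidable R \<gamma> (real (card T) * \<eta>) (\<Union>t\<in>T. S t)"
  using assms
proof (induction T rule: finite_ne_induct)
  case (insert t T)
  then have "avoidable R \<gamma> (\<eta> + real (card T) * \<eta>) (S t \<union> (\<Union>t\<in>T. S t))"
    by (intro avoidable_Un) auto
  then show ?case using insert by (simp add: distrib_right)
qed auto

section \<open>Hausdorff measure\<close>

text \<open>Any cover with small sum of \<open>diameter powr s\<close> is announced entirely at
  level 0, where relative lengths are absolute ones. Projection to the first coordinate does not
  increase diameters.\<close>

lemma avoidable_hausdorff_null: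
  fixes S :: "(real \<times> real) set"
  assumes R: "0 < R" and s: "0 < s" and \<eta>: "0 < \<eta>" and null: "hausdorff_measure s S = 0"
  shows "avoidable R s \<eta> (fst ` S)"
proof -
  have "hausdorff_pre s 1 S \<le> hausdorff_measure s S"
    unfolding hausdorff_measure_def by (rule SUP_upper) simp
  then have "hausdorff_pre s 1 S < ennreal (\<eta> / 2)" using null \<eta> by simp
  then obtain C :: "nat \<Rightarrow> (real \<times> real) set" where cov: "S \<subseteq> (\<Union>n. C n)" and bd: "\<And>n. bounded (C n)"
    and sC: "(\<Sum>n. ennreal (diameter (C n) powr s)) < ennreal (\<eta> / 2)"
    unfolding hausdorff_pre_def INF_less_iff by blast
  have sm: "summable (\<lambda>n. diameter (C n) powr s)"
    by (rule summable_suminf_not_top) (use sC in auto)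
  have le: "(\<Sum>n. diameter (C n) powr s) \<le> \<eta> / 2"
    using sC sm \<eta> by (simp add: suminf_ennreal2 ennreal_less_iff suminf_nonneg)
  \<comment> \<open>Diameters may vanish while weights must be positive; the cover gets half of
    \<open>\<eta>\<close>, and these positive fillers share the other half.\<close>
  define t where "t l = (\<eta> / 2 * (1 / 2) ^ Suc l) powr (1 / s)" for l :: nat
  have ts: "t l powr s = \<eta> / 2 * (1 / 2) ^ Suc l" for l
    using s \<eta> by (simp add: t_def powr_powr)
  have tsum: "(\<lambda>l. t l powr s) sums (\<eta> / 2)"
    unfolding ts using sums_mult[OF power_half_series, of "\<eta> / 2"] by simp
  define w where "w l = max (diameter (C l)) (t l)" for l
  have wp: "0 < w l" for l using \<eta> by (simp add: w_def t_def less_max_iff_disj)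
  have wle: "w l powr s \<le> diameter (C l) powr s + t l powr s" for l
    by (simp add: w_def max_def)
  have sw: "summable (\<lambda>l. w l powr s)"
    by (rule summable_comparison_test'[OF summable_add[OF sm sums_summable[OF tsum]], where N = 0])
      (use wle in auto)
  have "(\<Sum>l. w l powr s) \<le> (\<Sum>l. diameter (C l) powr s + t l powr s)"
    by (intro suminf_le sw summable_add sm sums_summable[OF tsum] wle)
  also have "\<dots> \<le> \<eta>"
    using le sums_unique[OF tsum] by (simp add: suminf_add[OF sm sums_summable[OF tsum], symmetric])
  finally have wsum: "(\<Sum>l. w l powr s) \<le> \<eta>" .
  have int: "\<exists>v. fst ` C l \<subseteq> {v..v + w l}" for l
  proof (cases "C l = {}")
    case False
    have d: "\<bar>x - y\<bar> \<le> diameter (C l)" if xy: "x \<in> fst ` C l" "y \<in> fst ` C l" for x y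
    proof -
      obtain p q where pq: "p \<in> C l" "q \<in> C l" "x = fst p" "y = fst q" using xy by blast
      have "dist x y \<le> dist p q" unfolding pq by (rule dist_fst_le)
      also have "\<dots> \<le> diameter (C l)" using pq bd by (intro diameter_bounded_bound) auto
      finally show ?thesis by (simp add: dist_real_def)
    qed
    have "bdd_below (fst ` C l)"
      by (intro bounded_imp_bdd_below bounded_fst bd)
    moreover have "x \<le> Inf (fst ` C l) + w l" if x: "x \<in> fst ` C l" for x
    proof -
      have "x - w l \<le> Inf (fst ` C l)"
      proof (rule cInf_greatest)
        fix y assume "y \<in> fst ` C l"
        with d[OF x this] show "x - w l \<le> y" by (simp add: w_def)
      qed (use False in simp)
      then show ?thesis by simp
    qed
    ultimately have "fst ` C l \<subseteq> {Inf (fst ` C l)..Inf (fst ` C l) + w l}"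
      by (meson atLeastAtMost_iff cInf_lower subsetI)
    then show ?thesis by blast
  qed auto
  define X where "X n l = (if n = 0 then fst ` C l else {})" for n l :: nat
  have "strategy R s \<eta> X w"
    unfolding strategy_def
  proof (intro conjI allI impI wp sw wsum)
    fix n u l
    show "\<exists>v. X n l \<inter> {u..u + R powr - real n} \<subseteq> {v..v + w l * R powr - real n}"
    proof (cases "n = 0")
      case True
      from int[of l] obtain v where "fst ` C l \<subseteq> {v..v + w l}" by blast
      then have "X n l \<inter> {u..u + R powr - real n} \<subseteq> {v..v + w l * R powr - real n}"
        using True R by (auto simp: X_def)
      then show ?thesis by blast
    qed (simp add: X_def)
  qed
  moreover have "fst ` S \<subseteq> (\<Union>n l. X n l)"
  proof
    fix x assume "x \<in> fst ` S"
    then obtain p where "p \<in> S" "x = fst p" by blast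
    moreover from this obtain l where "p \<in> C l" using cov by blast
    ultimately have "x \<in> X 0 l" by (simp add: X_def)
    then show "x \<in> (\<Union>n l. X n l)" by blast
  qed
  ultimately show ?thesis unfolding avoidable_def by blast
qed

text \<open>The line is cut into pieces of projected lengths \<open>h / (k + 1)\<close> in both
  directions. They exhaust the line because the harmonic series diverges, yet their
  \<open>s\<close>-th powers are summable for \<open>s > 1\<close>, with a sum tending to 0 with
  \<open>h\<close>.\<close>

lemma hausdorff_measure_line_eq_0:
  assumes s: "s > 1" and S: "S \<subseteq> line \<alpha> \<beta>"
  shows "hausdorff_measure s S = 0"
proof -
  define K where "K = 1 + \<bar>\<alpha>\<bar>"
  have K: "K \<ge> 1" by (simp add: K_def)
  define Z where "Z = (\<Sum>n. (1 / real (Suc n)) powr s)"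
  have sZ: "summable (\<lambda>n. (1 / real (Suc n)) powr s)"
  proof -
    have "summable (\<lambda>n. real (Suc n) powr (- s))"
      using s by (subst summable_Suc_iff) (simp add: summable_real_powr_iff)
    then show ?thesis by (simp add: powr_minus powr_divide inverse_eq_divide)
  qed
  have Z0: "Z \<ge> 0" unfolding Z_def by (intro suminf_nonneg sZ) auto
  have cover: "hausdorff_pre s \<delta> S \<le> ennreal (2 * (K * h) powr s * Z)" if h: "0 < h" "K * h \<le> \<delta>" for h \<delta>
  proof -
    define T where "T n = (\<Sum>k<n. h / real (Suc k))" for n
    have T0: "T 0 = 0" and TS: "T (Suc n) = T n + h / real (Suc n)" for n by (auto simp: T_def)
    have T_top: "\<exists>n. x < T n" for x
    proof (rule ccontr)
      assume "\<not> ?thesis"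
      then have "\<And>n. (\<Sum>k<n. h / real (Suc k)) \<le> x" by (simp add: T_def not_less)
      then have "summable (\<lambda>k. h / real (Suc k))"
        using h by (intro summableI_nonneg_bounded[where x = x]) auto
      then have "summable (\<lambda>k. inverse h * (h / real (Suc k)))" by (rule summable_mult)
      then have "summable (\<lambda>k. inverse (real (Suc k)))" using h by (simp add: field_simps)
      then have "summable (\<lambda>k. inverse (real k))" by (subst (asm) summable_Suc_iff)
      then show False using not_summable_harmonic[where 'a = real] by simp
    qed
    have T_ex: "\<exists>n. T n \<le> x \<and> x \<le> T (Suc n)" if "x \<ge> 0" for x
    proof -
      define m where "m = (LEAST n. x < T n)"
      have m: "x < T m" unfolding m_def using T_top by (rule LeastI_ex)
      then have "m \<noteq> 0" using that T0 by (intro notI) simp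
      then obtain n where n: "m = Suc n" using not0_implies_Suc by blast
      then have "\<not> x < T n" unfolding m_def by (metis lessI not_less_Least)
      then show ?thesis using m n by (intro exI[of _ n]) auto
    qed
    \<comment> \<open>Even indices cover the nonnegative half line, odd indices its mirror
      image.\<close>
    define I where "I n = (if even n then {T (n div 2)..T (Suc (n div 2))} else {- T (Suc (n div 2))..- T (n div 2)})" for n
    define C where "C n = (\<lambda>x. (x, \<alpha> * x + \<beta>)) ` I n" for n
    define g where "g n = K * h / real (Suc (n div 2))" for n
    have dC: "dist p q \<le> g n" if "p \<in> C n" "q \<in> C n" for p q n
    proof -
      obtain x y where xy: "x \<in> I n" "y \<in> I n" "p = (x, \<alpha> * x + \<beta>)" "q = (y, \<alpha> * y + \<beta>)"
        using \<open>p \<in> C n\<close> \<open>q \<in> C n\<close> unfolding C_def by blast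
      have xyh: "\<bar>x - y\<bar> \<le> h / real (Suc (n div 2))"
        using xy(1,2) by (auto simp: I_def TS abs_le_iff split: if_splits)
      have "dist p q \<le> dist x y + dist (\<alpha> * x + \<beta>) (\<alpha> * y + \<beta>)"
        unfolding xy dist_prod_def by (simp add: sqrt_sum_squares_le_sum)
      also have "\<dots> = K * \<bar>x - y\<bar>"
        by (simp add: dist_real_def K_def distrib_right abs_mult[symmetric] right_diff_distrib)
      also have "\<dots> \<le> K * (h / real (Suc (n div 2)))"
        using K xyh by (intro mult_left_mono) auto
      finally show ?thesis by (simp add: g_def)
    qed
    have g0: "0 \<le> g n" "g n \<le> \<delta>" for n
    proof -
      show "0 \<le> g n" using K h by (simp add: g_def)
      have "g n \<le> K * h / 1" unfolding g_def using K h by (intro divide_left_mono) auto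
      then show "g n \<le> \<delta>" using h by simp
    qed
    \<comment> \<open>For an empty piece the chosen centre is arbitrary and the bound is
      vacuous.\<close>
    have bC: "bounded (C n)" for n unfolding bounded_any_center[where a = "SOME p. p \<in> C n"]
      by (intro exI[of _ "g n"]) (use dC someI_ex[of "\<lambda>p. p \<in> C n"] in blast)
    have diam: "diameter (C n) \<le> g n" for n
      by (rule diameter_le) (use g0 dC in \<open>auto simp: dist_norm[symmetric]\<close>)
    have cov: "S \<subseteq> (\<Union>n. C n)"
    proof
      fix p assume "p \<in> S"
      then obtain x where p: "p = (x, \<alpha> * x + \<beta>)" using S by (auto simp: line_def)
      show "p \<in> (\<Union>n. C n)"
      proof (cases "x \<ge> 0")
        case True
        then obtain n where "T n \<le> x" "x \<le> T (Suc n)" using T_ex by blast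
        then have "x \<in> I (2 * n)" by (simp add: I_def)
        then show ?thesis unfolding C_def p by blast
      next
        case False
        then obtain n where "T n \<le> - x" "- x \<le> T (Suc n)" using T_ex[of "- x"] by auto
        then have "x \<in> I (Suc (2 * n))" by (simp add: I_def)
        then show ?thesis unfolding C_def p by blast
      qed
    qed
    have gs: "(\<lambda>n. g n powr s) sums ((K * h) powr s * Z + (K * h) powr s * Z)"
    proof -
      have "(\<lambda>n. (K * h) powr s * (1 / real (Suc n)) powr s) sums ((K * h) powr s * Z)"
        unfolding Z_def by (intro sums_mult summable_sums sZ)
      then have 1: "(\<lambda>n. (K * h / real (Suc n)) powr s) sums ((K * h) powr s * Z)"
        using K h by (simp add: powr_mult powr_divide)
      have "(\<lambda>n. if even n then (K * h / real (Suc (n div 2))) powr s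
              else (K * h / real (Suc ((n - 1) div 2))) powr s) sums ((K * h) powr s * Z + (K * h) powr s * Z)"
        by (rule sums_if[OF 1 1])
      moreover have "(if even n then (K * h / real (Suc (n div 2))) powr s
              else (K * h / real (Suc ((n - 1) div 2))) powr s) = g n powr s" for n
        by (auto simp: g_def elim!: oddE)
      ultimately show ?thesis by simp
    qed
    have "hausdorff_pre s \<delta> S \<le> (\<Sum>n. ennreal (diameter (C n) powr s))"
      unfolding hausdorff_pre_def
      by (rule INF_lower) (use cov bC diam g0 order_trans in blast)
    also have "\<dots> \<le> (\<Sum>n. ennreal (g n powr s))"
      by (intro suminf_le ennreal_leI powr_mono2 diam diameter_ge_0 bC) (use s in auto)
    also have "\<dots> = ennreal (\<Sum>n. g n powr s)"
      by (intro suminf_ennreal2 sums_summable[OF gs]) auto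
    also have "(\<Sum>n. g n powr s) = 2 * (K * h) powr s * Z"
      using sums_unique[OF gs] by (simp add: algebra_simps)
    finally show ?thesis .
  qed
  have "hausdorff_pre s \<delta> S = 0" if \<delta>: "\<delta> > 0" for \<delta>
  proof -
    have lim: "((\<lambda>h. 2 * (K * h) powr s * Z) \<longlongrightarrow> 0) (at_right 0)"
    proof -
      have "((\<lambda>h. (K * h) powr s) \<longlongrightarrow> (K * 0) powr s) (at_right 0)"
      proof (intro tendsto_powr' tendsto_mult tendsto_const tendsto_ident_at)
        have "eventually (\<lambda>h::real. 0 \<le> K * h) (at_right 0)"
          using eventually_at_right_less[of 0] by eventually_elim (use K in simp)
        then show "K * 0 \<noteq> 0 \<or> 0 < s \<and> (\<forall>\<^sub>F h in at_right 0. 0 \<le> K * h)"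
          using s by simp
      qed
      then have "((\<lambda>h. 2 * (K * h) powr s * Z) \<longlongrightarrow> 2 * (K * 0) powr s * Z) (at_right 0)"
        by (intro tendsto_mult tendsto_const)
      then show ?thesis by simp
    qed
    have "hausdorff_pre s \<delta> S \<le> 0"
    proof (rule tendsto_lowerbound)
      show "((\<lambda>h. ennreal (2 * (K * h) powr s * Z)) \<longlongrightarrow> 0) (at_right 0)"
        using tendsto_ennrealI[OF lim] by simp
      have "eventually (\<lambda>h. h < \<delta> / K) (at_right 0)"
        using \<delta> K by (intro order_tendstoD[OF tendsto_ident_at]) auto
      then show "eventually (\<lambda>h. hausdorff_pre s \<delta> S \<le> ennreal (2 * (K * h) powr s * Z)) (at_right 0)"
        using eventually_at_right_less[of 0]
      proof eventually_elim
        case (elim h)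
        then have "K * h \<le> \<delta>" using K by (simp add: pos_less_divide_eq mult.commute)
        then show ?case using elim by (intro cover) auto
      qed
    qed simp
    then show ?thesis by simp
  qed
  then have "hausdorff_measure s S \<le> 0"
    unfolding hausdorff_measure_def by (intro SUP_least) auto
  then show ?thesis by simp
qed

section \<open>Rational points and lines near a line\<close>

lemma abs_affine_le_interval:
  fixes e f g :: real
  assumes "e \<noteq> 0"
  shows "{x. \<bar>e * x + f\<bar> \<le> g} \<subseteq> {- f / e - g / \<bar>e\<bar>..- f / e - g / \<bar>e\<bar> + 2 * g / \<bar>e\<bar>}"
proof
  fix x assume "x \<in> {x. \<bar>e * x + f\<bar> \<le> g}"
  then have "\<bar>e * x + f\<bar> / \<bar>e\<bar> \<le> g / \<bar>e\<bar>" by (intro divide_right_mono) auto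
  moreover have "\<bar>e * x + f\<bar> / \<bar>e\<bar> = \<bar>x - (- f / e)\<bar>"
    using assms by (simp add: abs_divide[symmetric] add_divide_distrib)
  ultimately show "x \<in> {- f / e - g / \<bar>e\<bar>..- f / e - g / \<bar>e\<bar> + 2 * g / \<bar>e\<bar>}"
    by (auto simp: abs_le_iff)
qed

text \<open>\<open>R\<close> absorbs numerical constants and the factors
  \<open>\<bar>\<alpha>\<bar>\<close> and \<open>1 / \<bar>\<alpha>\<bar>\<close>. The exponent
  saving \<open>\<xi>\<close> comes from the Diophantine condition, and \<open>\<kappa>\<close> is
  the part of it spent on lengthening the intervals for lines. \<open>b\<close> makes the point
  obstacles short relative to their level; \<open>N\<close> is the threshold from which a line
  counts as nearly parallel.\<close>

locale line_pair =
  fixes R \<alpha> \<beta> i j \<kappa> \<xi> b :: real and N :: nat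
  assumes R8: "8 \<le> R" and R\<alpha>: "2 + \<bar>\<alpha>\<bar> \<le> R" and R\<alpha>': "2 \<le> R * \<bar>\<alpha>\<bar>"
    and ij: "0 < i" "0 < j" "i + j = 1"
    and \<kappa>: "0 < \<kappa>" "2 * \<kappa> \<le> \<xi>" "2 * \<kappa> \<le> min i j"
    and dio: "\<And>(m::nat) (A::int) (B::int). (A, B) \<noteq> (0, 0) \<Longrightarrow> \<bar>real_of_int A\<bar> \<le> R powr (m * i) \<Longrightarrow>
        \<bar>real_of_int B\<bar> \<le> R powr (m * j) \<Longrightarrow> R powr (- 1 - m * (1 - \<xi>)) \<le> \<bar>A + B * \<alpha>\<bar>"
    and b: "8 \<le> b" and N: "20 \<le> N * min i j" "2 * b \<le> \<kappa> * N"
begin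

text \<open>Up to constants, the neighbourhood of a rational point on the line has length
  \<open>q powr - (1 + \<mu>)\<close>: the larger weight gives the stronger restriction.\<close>

definition \<mu> where "\<mu> = max i j"

abbreviation E where "E x \<equiv> R powr x"

lemma R_pos: "0 < R" and R_gt1: "1 < R"
  using R8 by auto

lemma E_mono: "x \<le> y \<Longrightarrow> E x \<le> E y"
  using R_gt1 by (simp add: powr_mono)

lemma E_less_iff: "E x < E y \<longleftrightarrow> x < y"
  using R_gt1 by simp

lemma E_mult: "E x * E y = E (x + y)"
  by (simp add: powr_add)

lemma E_1: "E 1 = R"
  using R_pos by simp

lemma mult_E_le: "k \<le> R \<Longrightarrow> k * E x \<le> E (1 + x)"
  using R_pos by (simp add: powr_add mult_right_mono)

lemma E_pos: "0 < E x"
  using R_pos by simp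

lemma \<mu>: "i \<le> \<mu>" "j \<le> \<mu>" "\<mu> < 1" "1 / 2 \<le> \<mu>" "\<mu> = i \<or> \<mu> = j" "0 < \<mu>"
  using ij by (auto simp: \<mu>_def)

lemma \<kappa>_le: "2 * \<kappa> \<le> i" "2 * \<kappa> \<le> j" "\<kappa> \<le> 1 / 4"
  using \<kappa> ij by auto

lemma N_ge: "20 \<le> N" "20 \<le> N * i" "20 \<le> N * j"
proof -
  have "0 < min i j" "min i j \<le> 1" using ij by auto
  have "0 < N"
  proof (rule ccontr)
    assume "\<not> 0 < N"
    then have "N * min i j \<le> 0" using \<open>0 < min i j\<close> by (intro mult_nonpos_nonneg) auto
    with N show False by linarith
  qed
  then have "N * min i j \<le> N * i" "N * min i j \<le> N * j" "N * min i j \<le> real N * 1"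
    using ij by (intro mult_left_mono; auto)+
  with N show "20 \<le> N" "20 \<le> N * i" "20 \<le> N * j" by linarith+
qed

text \<open>The constant \<open>c\<close> in the definition of \<open>Bad i j\<close> is \<open>R powr (- N - b)\<close>. A rational line \<open>Ax + By + C = 0\<close> in
  \<open>line_class m k\<close> has height at most \<open>R\<^sup>m\<close>, and \<open>k\<close> measures how close it is to being parallel to
  \<open>y = \<alpha>x + \<beta>\<close>; only \<open>k \<ge> N\<close> matters. The levels are chosen so that the neighbourhoods are a bit
  shorter than \<open>R\<^sup>-\<^sup>n\<close> for points and, with room to spare for large \<open>k\<close>, for lines.\<close>

definition near_point :: "int \<Rightarrow> int \<Rightarrow> int \<Rightarrow> real set" where
  "near_point q p r = {x. \<bar>q * x - p\<bar> \<le> E (- N - b) * real_of_int q powr - i \<and>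
      \<bar>q * (\<alpha> * x + \<beta>) - r\<bar> \<le> E (- N - b) * real_of_int q powr - j}"

definition point_class :: "nat \<Rightarrow> int \<Rightarrow> bool" where
  "point_class m q \<longleftrightarrow> E (real m - 1) < q \<and> q \<le> E m"

text \<open>The affine form \<open>A x + B y + C\<close> restricted to
  \<open>y = \<alpha> x + \<beta>\<close>.\<close>

definition form :: "int \<Rightarrow> int \<Rightarrow> int \<Rightarrow> real \<Rightarrow> real" where
  "form A B C x = (A + B * \<alpha>) * x + (B * \<beta> + C)"

definition near_line :: "nat \<Rightarrow> int \<Rightarrow> int \<Rightarrow> int \<Rightarrow> real set" where
  "near_line m A B C = {x. \<bar>form A B C x\<bar> \<le> E (2 - real N - b - m)}"

definition line_class :: "nat \<Rightarrow> nat \<Rightarrow> int \<Rightarrow> int \<Rightarrow> bool" where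
  "line_class m k A B \<longleftrightarrow> (A, B) \<noteq> (0, 0) \<and> \<bar>real_of_int A\<bar> \<le> E (m * i) \<and> \<bar>real_of_int B\<bar> \<le> E (m * j) \<and>
     E (m * \<mu> - k - 1) < \<bar>A + B * \<alpha>\<bar> \<and> \<bar>A + B * \<alpha>\<bar> \<le> E (m * \<mu> - k)"

definition point_level :: "nat \<Rightarrow> nat" where
  "point_level m = nat \<lceil>m * (1 + \<mu>)\<rceil> + 2"

definition line_exponent :: "nat \<Rightarrow> nat \<Rightarrow> real" where
  "line_exponent m k = m * (1 + \<mu>) - k * (1 + \<kappa>) - 4 + N + b"

definition line_level :: "nat \<Rightarrow> nat \<Rightarrow> nat" where
  "line_level m k = nat \<lceil>line_exponent m k\<rceil>"

definition points :: "nat \<Rightarrow> real set" where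
  "points n = {x. \<exists>m q p r. point_level m = n \<and> point_class m q \<and> x \<in> near_point q p r}"

definition lines :: "nat \<Rightarrow> nat \<Rightarrow> real set" where
  "lines n k = {x. \<exists>m A B C. line_level m k = n \<and> line_class m k A B \<and> x \<in> near_line m A B C}"

section \<open>Bounds for levels and classes\<close>

lemma point_level_bounds: "m * (1 + \<mu>) + 2 \<le> point_level m" "point_level m < m * (1 + \<mu>) + 3"
proof -
  have "0 \<le> m * (1 + \<mu>)" using \<mu> by simp
  then have "0 \<le> \<lceil>m * (1 + \<mu>)\<rceil>" by linarith
  then show "m * (1 + \<mu>) + 2 \<le> point_level m" "point_level m < m * (1 + \<mu>) + 3"
    unfolding point_level_def by linarith+
qed

text \<open>As \<open>1 + \<mu> > 1\<close>, consecutive classes never round up to the same level.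
  All point obstacles of a level therefore have the same height class, as the simplex lemma
  requires.\<close>

lemma inj_point_level: "inj point_level"
proof (rule linorder_injI)
  fix m n :: nat assume "m < n"
  then have "1 * (1 + \<mu>) \<le> (real n - real m) * (1 + \<mu>)"
    using \<mu> by (intro mult_right_mono) auto
  then have "m * (1 + \<mu>) + 1 \<le> n * (1 + \<mu>)" using \<mu> by (simp add: left_diff_distrib)
  then show "point_level m \<noteq> point_level n"
    using point_level_bounds[of m] point_level_bounds[of n] by linarith
qed

text \<open>This is where the Diophantine condition on the slope enters.\<close>

lemma line_class_bound:
  assumes "line_class m k A B"
  shows "k \<le> m * (1 + \<mu>) - m * \<xi> + 1" "k \<le> 2 * real m + 1"
proof -
  have "E (- 1 - m * (1 - \<xi>)) \<le> \<bar>A + B * \<alpha>\<bar>" using assms by (intro dio) (auto simp: line_class_def)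
  also have "\<dots> \<le> E (m * \<mu> - k)" using assms by (auto simp: line_class_def)
  finally have "- 1 - m * (1 - \<xi>) \<le> m * \<mu> - k" using R_gt1 by simp
  then show 1: "k \<le> m * (1 + \<mu>) - m * \<xi> + 1" by (simp add: algebra_simps)
  have "m * (1 + \<mu>) \<le> real m * 2" "0 \<le> m * \<xi>" using \<mu> \<kappa> by (intro mult_left_mono, auto)
  then show "k \<le> 2 * real m + 1" using 1 by linarith
qed

text \<open>Guarantees that \<open>nat\<close> in \<open>line_level\<close> truncates nothing. Since
  \<open>k\<close> is at most \<open>2 * m + 1\<close>, the extra \<open>\<kappa> * k\<close> costs
  about \<open>2 * \<kappa> * m\<close>, which the saving \<open>m * \<xi>\<close> covers;
  \<open>N + b\<close> covers the constants.\<close>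

lemma line_exponent_nonneg:
  assumes "line_class m k A B"
  shows "0 \<le> line_exponent m k"
proof -
  have "\<kappa> * k \<le> \<kappa> * (2 * real m + 1)" using line_class_bound(2)[OF assms] \<kappa> by (intro mult_left_mono) auto
  moreover have "m * (2 * \<kappa>) \<le> m * \<xi>" using \<kappa> by (intro mult_left_mono) auto
  ultimately show ?thesis using line_class_bound(1)[OF assms] \<kappa>_le N_ge b
    unfolding line_exponent_def by (simp add: algebra_simps)
qed

lemma line_level_bounds:
  assumes "line_class m k A B"
  shows "line_exponent m k \<le> line_level m k" "line_level m k < line_exponent m k + 1"
  using line_exponent_nonneg[OF assms] unfolding line_level_def by linarith+

lemma line_level_inj:
  assumes "line_class m k A B" "line_class m' k A' B'" "line_level m k = line_level m' k"
  shows "m = m'"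
proof -
  have *: "n \<le> m" if "line_class m k A B" "line_class n k A' B'" "line_level m k = line_level n k" for m n A B A' B'
  proof (rule ccontr)
    assume "\<not> n \<le> m"
    then have "1 * (1 + \<mu>) \<le> (real n - real m) * (1 + \<mu>)"
      using \<mu> by (intro mult_right_mono) auto
    then have "m * (1 + \<mu>) + 1 \<le> n * (1 + \<mu>)" using \<mu> by (simp add: left_diff_distrib)
    then show False
      using that(3) line_level_bounds[OF that(1)] line_level_bounds[OF that(2)]
      unfolding line_exponent_def by linarith
  qed
  show ?thesis using *[OF assms] *[OF assms(2,1) assms(3)[symmetric]] by simp
qed

lemma point_class_pos: "point_class m q \<Longrightarrow> 0 < q"
  using E_pos[of "real m - 1"] unfolding point_class_def by linarith

lemma point_class_powr_le:
  assumes "point_class m q" "0 \<le> a"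
  shows "real_of_int q powr - a \<le> E (a - m * a)"
proof -
  have q: "0 < E (real m - 1)" "E (real m - 1) \<le> q" using assms E_pos by (auto simp: point_class_def)
  have "real_of_int q powr - a \<le> E (real m - 1) powr - a"
    by (rule powr_mono2') (use q assms in auto)
  also have "\<dots> = E (a - m * a)" by (simp add: powr_powr algebra_simps)
  finally show ?thesis .
qed

lemma point_class_ex:
  assumes "1 \<le> q"
  shows "\<exists>m. point_class m q"
proof -
  define y where "y = log R q"
  have y: "0 \<le> y" "E y = q" using assms R_gt1 by (auto simp: y_def)
  define m where "m = nat \<lceil>y\<rceil>"
  have "real m - 1 < y" "y \<le> m" using y(1) unfolding m_def by linarith+
  then have "point_class m q" unfolding point_class_def y(2)[symmetric] using R_gt1 by simp
  then show ?thesis ..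
qed

text \<open>The index \<open>k\<close> is read off from the logarithm of
  \<open>\<bar>A + B * \<alpha>\<bar>\<close>, which is nonzero by the Diophantine
  condition.\<close>

lemma line_class_ex:
  assumes "(A, B) \<noteq> (0, 0)" "\<bar>real_of_int A\<bar> \<le> E (m * i)" "\<bar>real_of_int B\<bar> \<le> E (m * j)"
    and "\<bar>A + B * \<alpha>\<bar> \<le> E (m * \<mu> - N)"
  shows "\<exists>k\<ge>N. line_class m k A B"
proof -
  have "0 < \<bar>A + B * \<alpha>\<bar>" using dio[OF assms(1-3)] E_pos by (rule less_le_trans[rotated])
  define y where "y = log R \<bar>A + B * \<alpha>\<bar>"
  have y: "E y = \<bar>A + B * \<alpha>\<bar>" unfolding y_def
    by (rule powr_log_cancel) (use \<open>0 < \<bar>A + B * \<alpha>\<bar>\<close> R_gt1 in auto)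
  have yN: "y \<le> m * \<mu> - N" using assms(4) y R_gt1 by (metis powr_le_cancel_iff)
  define k where "k = nat \<lfloor>m * \<mu> - y\<rfloor>"
  have "0 \<le> m * \<mu> - y" using yN N_ge by linarith
  then have k: "k \<le> m * \<mu> - y" "m * \<mu> - y < k + 1" unfolding k_def by linarith+
  have "real N < real (k + 1)" using k(2) yN by simp
  then have "N \<le> k" unfolding of_nat_less_iff by simp
  moreover have "line_class m k A B" unfolding line_class_def y[symmetric]
    using assms k R_gt1 by auto
  ultimately show ?thesis by blast
qed

section \<open>Rational points near a short interval\<close>

text \<open>Transfers the approximation from \<open>x\<close> to the left end \<open>u\<close>, so
  that all rational points near one interval can be compared at the same place. Moving by
  \<open>h\<close> changes the errors by about \<open>R powr (m * - \<mu>)\<close>, which is within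
  both tolerances as \<open>i\<close> and \<open>j\<close> are at most \<open>\<mu>\<close>.\<close>

lemma near_point_close:
  assumes P: "point_class m q" "x \<in> near_point q p r" and x: "u \<le> x" "x \<le> u + h" and h: "h \<le> E (- 2 - m * (1 + \<mu>))"
  shows "\<bar>q * u - p\<bar> \<le> E (- 1 - m * i)" "\<bar>q * (\<alpha> * u + \<beta>) - r\<bar> \<le> E (- 1 - m * j)"
proof -
  have c: "E (- N - b) * real_of_int q powr - a \<le> E (- 2 - m * a)" if "0 \<le> a" "a \<le> 1" for a :: real
  proof -
    have "E (- N - b) * real_of_int q powr - a \<le> E (- N - b) * E (a - m * a)"
      by (intro mult_left_mono point_class_powr_le P that) auto
    also have "\<dots> \<le> E (- 2 - m * a)" unfolding E_mult using that N_ge b by (intro E_mono) linarith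
    finally show ?thesis .
  qed
  have q: "0 < q" "q \<le> E m" using P(1) point_class_pos by (auto simp: point_class_def)
  have d: "q * (x - u) \<le> E (- 2 - m * a)" if "a \<le> \<mu>" for a :: real
  proof -
    have "q * (x - u) \<le> E m * E (- 2 - m * (1 + \<mu>))"
      using q x h by (intro mult_mono) auto
    also have "\<dots> \<le> E (- 2 - m * a)" unfolding E_mult
      using mult_left_mono[OF that, of m] by (intro E_mono) (simp add: algebra_simps)
    finally show ?thesis .
  qed
  have d0: "0 \<le> q * (x - u)" using q x by simp
  have "\<bar>q * u - p\<bar> \<le> \<bar>q * x - p\<bar> + q * (x - u)"
    using d0 by (simp add: right_diff_distrib)
  also have "\<dots> \<le> E (- 2 - m * i) + E (- 2 - m * i)"
    using P(2) c[of i] d[of i] ij \<mu> unfolding near_point_def by auto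
  also have "\<dots> = 2 * E (- 2 - m * i)" by simp
  also have "\<dots> \<le> E (- 1 - m * i)" using mult_E_le[of 2 "- 2 - m * i"] R8 by simp
  finally show "\<bar>q * u - p\<bar> \<le> E (- 1 - m * i)" .
  have eq: "q * (\<alpha> * u + \<beta>) - r = (q * (\<alpha> * x + \<beta>) - r) - \<alpha> * (q * (x - u))" by (simp add: algebra_simps)
  have "\<bar>q * (\<alpha> * u + \<beta>) - r\<bar> \<le> \<bar>q * (\<alpha> * x + \<beta>) - r\<bar> + \<bar>\<alpha>\<bar> * (q * (x - u))"
    unfolding eq using d0 abs_triangle_ineq4[of "q * (\<alpha> * x + \<beta>) - r" "\<alpha> * (q * (x - u))"]
    by (simp add: abs_mult[of \<alpha>])
  also have "\<dots> \<le> E (- 2 - m * j) + \<bar>\<alpha>\<bar> * E (- 2 - m * j)"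
    using P(2) c[of j] d[of j] ij \<mu> unfolding near_point_def by (intro add_mono mult_left_mono) auto
  also have "\<dots> = (1 + \<bar>\<alpha>\<bar>) * E (- 2 - m * j)" by (simp add: distrib_right)
  also have "\<dots> \<le> E (- 1 - m * j)" using mult_E_le[of "1 + \<bar>\<alpha>\<bar>" "- 2 - m * j"] R\<alpha> by simp
  finally show "\<bar>q * (\<alpha> * u + \<beta>) - r\<bar> \<le> E (- 1 - m * j)" .
qed

lemma abs_cross_le:
  fixes a1 a2 b1 b2 s t :: real
  assumes "\<bar>a1\<bar> \<le> s" "\<bar>a2\<bar> \<le> s" "\<bar>b1\<bar> \<le> t" "\<bar>b2\<bar> \<le> t"
  shows "\<bar>a1 * b2 - a2 * b1\<bar> \<le> 2 * (s * t)"
proof -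
  have "\<bar>a1 * b2\<bar> \<le> s * t" "\<bar>a2 * b1\<bar> \<le> s * t"
    unfolding abs_mult using assms by (intro mult_mono; linarith)+
  then show ?thesis by linarith
qed

text \<open>The simplex lemma: the determinant is an integer of absolute value less than one.\<close>

lemma near_points_collinear:
  assumes P: "point_class m q1" "point_class m q2" "point_class m q3"
    and X: "\<bar>q1 * u - p1\<bar> \<le> E (- 1 - m * i)" "\<bar>q2 * u - p2\<bar> \<le> E (- 1 - m * i)" "\<bar>q3 * u - p3\<bar> \<le> E (- 1 - m * i)"
    and Y: "\<bar>q1 * y - r1\<bar> \<le> E (- 1 - m * j)" "\<bar>q2 * y - r2\<bar> \<le> E (- 1 - m * j)" "\<bar>q3 * y - r3\<bar> \<le> E (- 1 - m * j)"
  shows "(q2 * r1 - q1 * r2) * p3 + (q1 * p2 - q2 * p1) * r3 + (p1 * r2 - p2 * r1) * q3 = (0::int)"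
    (is "?D = 0")
proof -
  have q: "\<bar>real_of_int q\<bar> \<le> E m" if "point_class m q" for q
    using that point_class_pos[OF that] by (simp add: point_class_def)
  let ?X1 = "q1 * u - p1" and ?X2 = "q2 * u - p2" and ?X3 = "q3 * u - p3"
  let ?Y1 = "q1 * y - r1" and ?Y2 = "q2 * y - r2" and ?Y3 = "q3 * y - r3"
  have eq: "real_of_int ?D = (?X1 * ?Y2 - ?X2 * ?Y1) * q3 + (?X2 * ?Y3 - ?X3 * ?Y2) * q1 + (?X3 * ?Y1 - ?X1 * ?Y3) * q2"
    by (simp add: algebra_simps)
  have "\<bar>(a1 * b2 - a2 * b1) * real_of_int q\<bar> \<le> 2 * E (- 2)"
    if "\<bar>a1\<bar> \<le> E (- 1 - m * i)" "\<bar>a2\<bar> \<le> E (- 1 - m * i)" "\<bar>b1\<bar> \<le> E (- 1 - m * j)" "\<bar>b2\<bar> \<le> E (- 1 - m * j)"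
      "point_class m q" for a1 a2 b1 b2 q
  proof -
    have "\<bar>(a1 * b2 - a2 * b1) * real_of_int q\<bar> \<le> 2 * (E (- 1 - m * i) * E (- 1 - m * j)) * E m"
      unfolding abs_mult[of "a1 * b2 - a2 * b1"] by (intro mult_mono abs_cross_le that q) auto
    also have "\<dots> = 2 * E ((- 1 - m * i) + (- 1 - m * j) + m)" by (simp add: E_mult mult.assoc)
    also have "(- 1 - m * i) + (- 1 - m * j) + m = - 2 - m * (i + j) + m" by (simp add: algebra_simps)
    also have "\<dots> = - 2" using ij by simp
    finally show ?thesis .
  qed
  then have "\<bar>(?X1 * ?Y2 - ?X2 * ?Y1) * q3\<bar> \<le> 2 * E (- 2)" "\<bar>(?X2 * ?Y3 - ?X3 * ?Y2) * q1\<bar> \<le> 2 * E (- 2)"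
     "\<bar>(?X3 * ?Y1 - ?X1 * ?Y3) * q2\<bar> \<le> 2 * E (- 2)" using X Y P by blast+
  then have "\<bar>real_of_int ?D\<bar> \<le> 6 * E (- 2)" unfolding eq by linarith
  also have "\<dots> \<le> E (- 1)" using mult_E_le[of 6 "- 2"] R8 by simp
  also have "\<dots> < E 0" unfolding E_less_iff by simp
  finally have "\<bar>real_of_int ?D\<bar> < 1" using R_pos by simp
  then show ?thesis by linarith
qed

text \<open>The coefficients are cross products of the homogeneous coordinates, unchanged when
  \<open>p\<close> and \<open>r\<close> are replaced by the small errors at \<open>u\<close> up to
  sign. With \<open>i + j = 1\<close> the height bounds come out as \<open>m * i\<close> and
  \<open>m * j\<close>.\<close>

lemma line_through_near_points:
  assumes P: "point_class m q1" "point_class m q2"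
    and X: "\<bar>q1 * u - p1\<bar> \<le> E (- 1 - m * i)" "\<bar>q2 * u - p2\<bar> \<le> E (- 1 - m * i)"
    and Y: "\<bar>q1 * y - r1\<bar> \<le> E (- 1 - m * j)" "\<bar>q2 * y - r2\<bar> \<le> E (- 1 - m * j)"
  shows "\<bar>real_of_int (q2 * r1 - q1 * r2)\<bar> \<le> 2 * E (m * i - 1)" "\<bar>real_of_int (q1 * p2 - q2 * p1)\<bar> \<le> 2 * E (m * j - 1)"
proof -
  have q: "\<bar>real_of_int q\<bar> \<le> E m" if "point_class m q" for q
    using that point_class_pos[OF that] by (simp add: point_class_def)
  have "real m = m * i + m * j" using ij by (simp add: distrib_left[symmetric])
  then have mm: "real m + (- 1 - m * j) = m * i - 1" "real m + (- 1 - m * i) = m * j - 1" by linarith+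
  have "\<bar>q1 * (q2 * y - r2) - q2 * (q1 * y - r1)\<bar> \<le> 2 * (E m * E (- 1 - m * j))"
    by (intro abs_cross_le q P Y)
  then show "\<bar>real_of_int (q2 * r1 - q1 * r2)\<bar> \<le> 2 * E (m * i - 1)"
    unfolding E_mult mm by (simp add: algebra_simps)
  have "\<bar>q2 * (q1 * u - p1) - q1 * (q2 * u - p2)\<bar> \<le> 2 * (E m * E (- 1 - m * i))"
    by (intro abs_cross_le q P X)
  then show "\<bar>real_of_int (q1 * p2 - q2 * p1)\<bar> \<le> 2 * E (m * j - 1)"
    unfolding E_mult mm by (simp add: algebra_simps)
qed

text \<open>For a rational point on the line, \<open>q * form A B C x\<close> is \<open>A\<close>
  times the first error plus \<open>B\<close> times the second; the weights cancel against the
  heights of \<open>A\<close> and \<open>B\<close>.\<close>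

lemma near_point_near_line:
  assumes P: "point_class m q" "x \<in> near_point q p r"
    and L: "A * p + B * r + C * q = 0" "\<bar>real_of_int A\<bar> \<le> 2 * E (m * i - 1)" "\<bar>real_of_int B\<bar> \<le> 2 * E (m * j - 1)"
  shows "x \<in> near_line m A B C"
proof -
  have q: "0 < q" "E (real m - 1) \<le> q" using P(1) point_class_pos by (auto simp: point_class_def)
  have c: "2 * E (m * a - 1) * (E (- N - b) * real_of_int q powr - a) \<le> 2 * E (- N - b)" if "0 \<le> a" "a \<le> 1" for a :: real
  proof -
    have "2 * E (m * a - 1) * (E (- N - b) * real_of_int q powr - a) \<le> 2 * E (m * a - 1) * (E (- N - b) * E (a - m * a))"
      by (intro mult_left_mono point_class_powr_le P that) auto
    also have "\<dots> = 2 * E (a - 1 - real N - b)" by (simp add: E_mult mult.assoc algebra_simps)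
    also have "\<dots> \<le> 2 * E (- N - b)" using that by (intro mult_left_mono E_mono) auto
    finally show ?thesis .
  qed
  have L': "real_of_int A * p + B * r + C * q = 0" using L(1) by (metis of_int_0 of_int_add of_int_mult)
  have "q * form A B C x = A * (q * x - p) + B * (q * (\<alpha> * x + \<beta>) - r) + (real_of_int A * p + B * r + C * q)"
    by (simp add: form_def algebra_simps)
  then have eq: "q * form A B C x = A * (q * x - p) + B * (q * (\<alpha> * x + \<beta>) - r)" using L' by simp
  have "\<bar>A * (q * x - p)\<bar> \<le> 2 * E (m * i - 1) * (E (- N - b) * real_of_int q powr - i)"
    unfolding abs_mult using P(2) L by (intro mult_mono) (auto simp: near_point_def)
  moreover have "\<bar>B * (q * (\<alpha> * x + \<beta>) - r)\<bar> \<le> 2 * E (m * j - 1) * (E (- N - b) * real_of_int q powr - j)"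
    unfolding abs_mult using P(2) L by (intro mult_mono) (auto simp: near_point_def)
  ultimately have "\<bar>q * form A B C x\<bar> \<le> 4 * E (- N - b)"
    unfolding eq using c[of i] c[of j] ij by linarith
  also have "\<dots> \<le> E (1 - real N - b)" using mult_E_le[of 4 "- N - b"] R8 by (simp add: algebra_simps)
  finally have "q * \<bar>form A B C x\<bar> \<le> E (1 - real N - b)" using q by (simp add: abs_mult)
  moreover have "E (real m - 1) * \<bar>form A B C x\<bar> \<le> q * \<bar>form A B C x\<bar>" using q by (intro mult_right_mono) auto
  moreover have "E (1 - real N - b) = E (real m - 1) * E (2 - real N - b - m)"
    unfolding E_mult by (simp add: algebra_simps)
  ultimately have "E (real m - 1) * \<bar>form A B C x\<bar> \<le> E (real m - 1) * E (2 - real N - b - m)"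
    by linarith
  then show ?thesis unfolding near_line_def using E_pos[of "real m - 1"] by simp
qed

text \<open>Either all rational points involved coincide, or they span one rational line. That line
  cannot be nearly parallel, since its own obstacle has been avoided, so its neighbourhood is a
  short interval.\<close>

lemma points_strategy:
  assumes disj: "\<And>n' k. N \<le> k \<Longrightarrow> E (- real n) \<le> E (- \<kappa> * k / 2) * E (- real n') \<Longrightarrow>
      {u..u + E (- real n)} \<inter> lines n' k = {}"
  shows "\<exists>v. points n \<inter> {u..u + E (- real n)} \<subseteq> {v..v + E (6 - b) * E (- real n)}"
proof (cases "points n \<inter> {u..u + E (- real n)} = {}")
  case False
  let ?J = "{u..u + E (- real n)}" and ?Y = "\<alpha> * u + \<beta>"
  obtain x1 m q1 p1 r1 where x1: "x1 \<in> ?J" and n: "point_level m = n"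
    and P1: "point_class m q1" "x1 \<in> near_point q1 p1 r1"
    using False unfolding points_def by blast
  note nb = point_level_bounds[of m, unfolded n]
  have h: "E (- real n) \<le> E (- 2 - m * (1 + \<mu>))" using nb by (intro E_mono) linarith
  have close: "\<bar>q * u - p\<bar> \<le> E (- 1 - m * i)" "\<bar>q * ?Y - r\<bar> \<le> E (- 1 - m * j)"
    if "point_class m q" "x \<in> near_point q p r" "x \<in> ?J" for q p r x
    using near_point_close[OF that(1,2) _ _ h] that(3) by auto
  have cover: "\<exists>q p r. point_class m q \<and> x \<in> near_point q p r" if "x \<in> points n" for x
    using that inj_point_level n unfolding points_def inj_def by blast
  have shrink: "{a..a + l} \<subseteq> {a..a + E (6 - b) * E (- real n)}" if "l \<le> E (3 - b - m * (1 + \<mu>))" for a l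
  proof -
    have "E (3 - b - m * (1 + \<mu>)) \<le> E (6 - b) * E (- real n)"
      unfolding E_mult using nb by (intro E_mono) linarith
    then show ?thesis using that by auto
  qed
  show ?thesis
  \<comment> \<open>The last conjunct says that the second rational point differs from the
    first.\<close>
  proof (cases "\<exists>q2 p2 r2 x2. x2 \<in> ?J \<and> point_class m q2 \<and> x2 \<in> near_point q2 p2 r2 \<and>
      (q2 * r1 - q1 * r2, q1 * p2 - q2 * p1) \<noteq> (0, 0)")
    case True
    then obtain q2 p2 r2 x2 where x2: "x2 \<in> ?J" and P2: "point_class m q2" "x2 \<in> near_point q2 p2 r2"
      and ne: "(q2 * r1 - q1 * r2, q1 * p2 - q2 * p1) \<noteq> (0, 0)" by blast
    define A B C where "A = q2 * r1 - q1 * r2" and "B = q1 * p2 - q2 * p1" and "C = p1 * r2 - p2 * r1"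
    have AB: "\<bar>real_of_int A\<bar> \<le> 2 * E (m * i - 1)" "\<bar>real_of_int B\<bar> \<le> 2 * E (m * j - 1)"
      unfolding A_def B_def
      by (intro line_through_near_points[OF P1(1) P2(1) close(1)[OF P1 x1] close(1)[OF P2 x2] close(2)[OF P1 x1] close(2)[OF P2 x2]])+
    then have AB': "\<bar>real_of_int A\<bar> \<le> E (m * i)" "\<bar>real_of_int B\<bar> \<le> E (m * j)"
      using mult_E_le[of 2 "m * i - 1"] mult_E_le[of 2 "m * j - 1"] R8 by auto
    have sub: "points n \<inter> ?J \<subseteq> near_line m A B C"
    proof
      fix x assume x: "x \<in> points n \<inter> ?J"
      then obtain q p r where P: "point_class m q" "x \<in> near_point q p r" using cover by blast
      have "A * p + B * r + C * q = 0" unfolding A_def B_def C_def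
        using x by (intro near_points_collinear[OF P1(1) P2(1) P(1) close(1)[OF P1 x1] close(1)[OF P2 x2] close(1)[OF P]
          close(2)[OF P1 x1] close(2)[OF P2 x2] close(2)[OF P]]) auto
      then show "x \<in> near_line m A B C" by (intro near_point_near_line[OF P _ AB])
    qed
    have big: "E (m * \<mu> - N) < \<bar>A + B * \<alpha>\<bar>"
    proof (rule ccontr)
      assume "\<not> ?thesis"
      then obtain k where k: "N \<le> k" "line_class m k A B"
        using line_class_ex[of A B m] ne AB' unfolding A_def B_def by force
      have "\<kappa> * N \<le> \<kappa> * k" using k \<kappa> by (intro mult_left_mono) auto
      \<comment> \<open>The levels differ by more than
        \<open>5 + (k - N) + \<kappa> * k - b\<close>, and
        \<open>2 * b \<le> \<kappa> * N \<le> \<kappa> * k\<close> makes this at least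
        \<open>\<kappa> * k / 2\<close>. So the obstacle of this line is among those already
        avoided, although \<open>x1\<close> lies in it.\<close>
      then have "- real n \<le> - \<kappa> * k / 2 + - real (line_level m k)"
        using line_level_bounds(2)[OF k(2)] nb k(1) b N unfolding line_exponent_def
        by (simp add: algebra_simps)
      then have "E (- real n) \<le> E (- \<kappa> * k / 2) * E (- real (line_level m k))"
        unfolding E_mult by (rule E_mono)
      then have "?J \<inter> lines (line_level m k) k = {}" by (rule disj[OF k(1)])
      moreover have "x1 \<in> near_line m A B C"
        using sub x1 P1 n unfolding points_def by blast
      then have "x1 \<in> lines (line_level m k) k" using k unfolding lines_def by blast
      ultimately show False using x1 by blast
    qed
    then have ne0: "A + B * \<alpha> \<noteq> 0" using E_pos[of "m * \<mu> - N"] by auto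
    let ?e = "\<bar>A + B * \<alpha>\<bar>" and ?g = "E (2 - real N - b - m)"
    have "2 * ?g / ?e \<le> 2 * ?g / E (m * \<mu> - N)"
      using big E_pos by (intro divide_left_mono) (auto intro!: mult_pos_pos order.strict_trans[OF E_pos big])
    also have "\<dots> = 2 * E (2 - real N - b - m - (m * \<mu> - N))"
      unfolding powr_diff[of R "2 - real N - b - m"] by simp
    also have "\<dots> = 2 * E (2 - b - m * (1 + \<mu>))" by (simp add: algebra_simps)
    also have "\<dots> \<le> E (3 - b - m * (1 + \<mu>))"
      using mult_E_le[of 2 "2 - b - m * (1 + \<mu>)"] R8 by (simp add: algebra_simps)
    finally have len: "2 * ?g / ?e \<le> E (3 - b - m * (1 + \<mu>))" .
    show ?thesis
      using sub abs_affine_le_interval[OF ne0, of "B * \<beta> + C" ?g] shrink[OF len]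
      unfolding near_line_def form_def by blast
  next
    case False
    have par: "q * r1 = q1 * r" "q1 * p = q * p1" if "point_class m q" "x \<in> near_point q p r" "x \<in> ?J" for q p r x
      using False that by auto
    have q1: "0 < q1" using point_class_pos[OF P1(1)] .
    have g: "z \<le> E (2 - real N - b - m * (1 + a))"
      if "point_class m q" "q * z \<le> E (- N - b) * real_of_int q powr - a" "0 \<le> a" "a \<le> 1"
      for q :: int and a z :: real
    proof -
      have q: "0 < real_of_int q" using point_class_pos[OF that(1)] by simp
      have "z \<le> E (- N - b) * (real_of_int q powr - a / q)"
        using that(2) q by (simp add: field_simps)
      also have "real_of_int q powr - a / q = real_of_int q powr - (a + 1)"
        using q by (simp add: powr_diff powr_minus)
      also have "E (- N - b) * real_of_int q powr - (a + 1) \<le> E (- N - b) * E ((a + 1) - m * (a + 1))"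
        by (intro mult_left_mono point_class_powr_le that) (use that in auto)
      also have "\<dots> \<le> E (2 - real N - b - m * (1 + a))" unfolding E_mult
        using that by (intro E_mono) (simp add: algebra_simps)
      finally show ?thesis .
    qed
    let ?g = "E (2 - real N - b - m * (1 + \<mu>))"
    have E1: "R * ?g \<le> E (3 - b - m * (1 + \<mu>))"
    proof -
      have "R * ?g = E (1 + (2 - real N - b - m * (1 + \<mu>)))" unfolding powr_add using E_1 by simp
      also have "\<dots> \<le> E (3 - b - m * (1 + \<mu>))" by (intro E_mono) simp
      finally show ?thesis .
    qed
    \<comment> \<open>Only one rational point remains. The coordinate of larger weight gives the
      short interval; for the second coordinate the length is divided by
      \<open>\<bar>\<alpha>\<bar>\<close>, which costs a factor absorbed by
      \<open>R\<close>.\<close>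
    consider "\<mu> = i" | "\<mu> = j" using \<mu> by blast
    then show ?thesis
    proof cases
      case 1
      have "points n \<inter> ?J \<subseteq> {x. \<bar>1 * x + (- p1 / q1)\<bar> \<le> ?g}"
      proof
        fix x assume x: "x \<in> points n \<inter> ?J"
        then obtain q p r where P: "point_class m q" "x \<in> near_point q p r" using cover by blast
        have q: "0 < q" using point_class_pos[OF P(1)] .
        have "real_of_int q1 * p = real_of_int q * p1" using par(2)[OF P] x by (metis Int_iff of_int_mult)
        then have "q * x - p = q * (1 * x + (- p1 / q1))"
          using q q1 by (simp add: field_simps)
        then have "\<bar>q * x - p\<bar> = q * \<bar>1 * x + (- p1 / q1)\<bar>"
          using q by (simp add: abs_mult)
        then have "q * \<bar>1 * x + (- p1 / q1)\<bar> \<le> E (- N - b) * real_of_int q powr - i"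
          using P(2) by (simp add: near_point_def)
        from g[OF P(1) this] show "x \<in> {x. \<bar>1 * x + (- p1 / q1)\<bar> \<le> ?g}" using ij 1 by simp
      qed
      also note abs_affine_le_interval
      also have "{- (- p1 / q1) / 1 - ?g / \<bar>1\<bar>..- (- p1 / q1) / 1 - ?g / \<bar>1\<bar> + 2 * ?g / \<bar>1\<bar>}
          \<subseteq> {- (- p1 / q1) / 1 - ?g / \<bar>1\<bar>..- (- p1 / q1) / 1 - ?g / \<bar>1\<bar> + E (6 - b) * E (- real n)}"
      proof (rule shrink)
        have "2 * ?g \<le> R * ?g" using R8 by (intro mult_right_mono) auto
        then show "2 * ?g / \<bar>1\<bar> \<le> E (3 - b - m * (1 + \<mu>))" using E1 by simp
      qed
      finally show ?thesis by auto
    next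
      case 2
      have \<alpha>0: "\<alpha> \<noteq> 0" using R\<alpha>' by auto
      have "points n \<inter> ?J \<subseteq> {x. \<bar>\<alpha> * x + (\<beta> - r1 / q1)\<bar> \<le> ?g}"
      proof
        fix x assume x: "x \<in> points n \<inter> ?J"
        then obtain q p r where P: "point_class m q" "x \<in> near_point q p r" using cover by blast
        have q: "0 < q" using point_class_pos[OF P(1)] .
        have "real_of_int q * r1 = real_of_int q1 * r" using par(1)[OF P] x by (metis Int_iff of_int_mult)
        then have "q * (\<alpha> * x + \<beta>) - r = q * (\<alpha> * x + (\<beta> - r1 / q1))"
          using q q1 by (simp add: field_simps)
        then have "\<bar>q * (\<alpha> * x + \<beta>) - r\<bar> = q * \<bar>\<alpha> * x + (\<beta> - r1 / q1)\<bar>"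
          using q by (simp add: abs_mult)
        then have "q * \<bar>\<alpha> * x + (\<beta> - r1 / q1)\<bar> \<le> E (- N - b) * real_of_int q powr - j"
          using P(2) by (simp add: near_point_def)
        from g[OF P(1) this] show "x \<in> {x. \<bar>\<alpha> * x + (\<beta> - r1 / q1)\<bar> \<le> ?g}" using ij 2 by simp
      qed
      moreover note abs_affine_le_interval[OF \<alpha>0, of "\<beta> - r1 / q1" ?g]
      moreover have "2 * ?g / \<bar>\<alpha>\<bar> \<le> E (3 - b - m * (1 + \<mu>))"
      proof -
        have "2 * ?g / \<bar>\<alpha>\<bar> \<le> (R * \<bar>\<alpha>\<bar>) * ?g / \<bar>\<alpha>\<bar>"
          using R\<alpha>' by (intro divide_right_mono mult_right_mono) auto
        then show ?thesis using E1 \<alpha>0 by simp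
      qed
      note shrink[OF this]
      ultimately show ?thesis by blast
    qed
  qed
qed auto

section \<open>Nearly parallel rational lines near a short interval\<close>

text \<open>Moves the estimate to the left end \<open>u\<close>. The intervals are longer than the
  neighbourhood by about \<open>R powr (\<kappa> * k)\<close>, and this factor is lost in the
  bound.\<close>

lemma line_class_near_form:
  assumes L: "line_class m k A B" "x \<in> near_line m A B C" and x: "u \<le> x" "x \<le> u + h"
    and h: "h \<le> E (- line_exponent m k)"
  shows "\<bar>form A B C u\<bar> \<le> E (5 + \<kappa> * k - N - b - m)"
proof -
  have "form A B C u = form A B C x - (A + B * \<alpha>) * (x - u)" by (simp add: form_def algebra_simps)
  then have "\<bar>form A B C u\<bar> \<le> \<bar>form A B C x\<bar> + \<bar>A + B * \<alpha>\<bar> * (x - u)"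
    using x abs_triangle_ineq4[of "form A B C x" "(A + B * \<alpha>) * (x - u)"] by (simp add: abs_mult)
  also have "\<dots> \<le> E (2 - real N - b - m) + E (m * \<mu> - k) * E (- line_exponent m k)"
    using L x h unfolding near_line_def line_class_def by (intro add_mono mult_mono) auto
  also have "\<dots> = E (2 - real N - b - m) + E (4 + \<kappa> * k - N - b - m)"
    unfolding E_mult line_exponent_def by (simp add: algebra_simps)
  also have "\<dots> \<le> E (4 + \<kappa> * k - N - b - m) + E (4 + \<kappa> * k - N - b - m)"
    using \<kappa> by (intro add_mono E_mono) auto
  also have "\<dots> = 2 * E (4 + \<kappa> * k - N - b - m)" by simp
  also have "\<dots> \<le> E (1 + (4 + \<kappa> * k - N - b - m))" by (rule mult_E_le) (use R8 in simp)
  finally show ?thesis by (simp add: algebra_simps)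
qed

text \<open>The two lines meet in \<open>(p/q, r/q)\<close>. The gain \<open>R\<^sup>-\<^sup>k\<close> in the bound for \<open>q\<close>, due to the lines being nearly
  parallel to \<open>y = \<alpha>x + \<beta>\<close>, pays for the loss \<open>R\<^sup>\<kappa>\<^sup>k\<close> in the other two bounds.\<close>

lemma line_intersection_bounds:
  assumes L: "line_class m k A1 B1" "line_class m k A2 B2"
    and F: "\<bar>form A1 B1 C1 u\<bar> \<le> E (5 + \<kappa> * k - N - b - m)" "\<bar>form A2 B2 C2 u\<bar> \<le> E (5 + \<kappa> * k - N - b - m)"
  defines "q \<equiv> A1 * B2 - A2 * B1" and "p \<equiv> B1 * C2 - B2 * C1" and "r \<equiv> A2 * C1 - A1 * C2"
  shows "\<bar>real_of_int q\<bar> \<le> E (1 + real m - k)"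
    and "\<bar>q * u - p\<bar> \<le> E (6 + \<kappa> * k - N - b - m * i)"
    and "\<bar>q * (\<alpha> * u + \<beta>) - r\<bar> \<le> E (6 + \<kappa> * k - N - b - m * j)"
proof -
  note L = L[unfolded line_class_def]
  have mm: "real m = m * i + m * j" using ij by (simp add: distrib_left[symmetric])
  have 2: "2 * E x \<le> E (1 + x)" for x using R8 by (intro mult_E_le) auto
  show "\<bar>real_of_int q\<bar> \<le> E (1 + real m - k)"
  proof -
    \<comment> \<open>The small factor \<open>A + B * \<alpha>\<close> is paired with the
      coefficient of smaller weight, so that the exponents of \<open>m\<close> add up to
      \<open>m\<close>. In the second case this yields \<open>\<alpha> * q\<close>, and dividing by
      \<open>\<alpha>\<close> uses up the factor 2.\<close>
    consider "\<mu> = i" | "\<mu> = j" using \<mu> by blast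
    then show ?thesis
    proof cases
      case 1
      have "q = (A1 + B1 * \<alpha>) * B2 - (A2 + B2 * \<alpha>) * B1" by (simp add: q_def algebra_simps)
      also have "\<bar>\<dots>\<bar> \<le> 2 * (E (m * \<mu> - k) * E (m * j))" using L by (intro abs_cross_le) auto
      also have "\<dots> = 2 * E (real m - k)" unfolding E_mult 1 using mm by (simp add: algebra_simps)
      also have "\<dots> \<le> E (1 + real m - k)" using 2[of "real m - k"] by (simp add: algebra_simps)
      finally show ?thesis .
    next
      case 2
      have "\<alpha> * q = A1 * (A2 + B2 * \<alpha>) - A2 * (A1 + B1 * \<alpha>)" by (simp add: q_def algebra_simps)
      also have "\<bar>\<dots>\<bar> \<le> 2 * (E (m * i) * E (m * \<mu> - k))" using L by (intro abs_cross_le) auto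
      also have "\<dots> = 2 * E (real m - k)" unfolding E_mult 2 using mm by (simp add: algebra_simps)
      finally have "\<bar>\<alpha>\<bar> * \<bar>real_of_int q\<bar> \<le> 2 * E (real m - k)" by (simp add: abs_mult)
      also have "\<dots> \<le> R * \<bar>\<alpha>\<bar> * E (real m - k)" using R\<alpha>' by (intro mult_right_mono) auto
      finally have "\<bar>\<alpha>\<bar> * \<bar>real_of_int q\<bar> \<le> \<bar>\<alpha>\<bar> * (R * E (real m - k))" by (simp add: ac_simps)
      moreover have "0 < \<bar>\<alpha>\<bar>" using R\<alpha>' by auto
      ultimately have "\<bar>real_of_int q\<bar> \<le> R * E (real m - k)" by simp
      also have "\<dots> = E (1 + (real m - k))" unfolding powr_add using E_1 by simp
      finally show ?thesis by (simp add: algebra_simps)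
    qed
  qed
  have "q * u - p = B2 * form A1 B1 C1 u - B1 * form A2 B2 C2 u"
    by (simp add: q_def p_def form_def algebra_simps)
  also have "\<bar>\<dots>\<bar> \<le> 2 * (E (m * j) * E (5 + \<kappa> * k - N - b - m))"
    using L F by (intro abs_cross_le) auto
  also have "\<dots> = 2 * E (m * j + (5 + \<kappa> * k - N - b - m))" unfolding E_mult ..
  also have "m * j + (5 + \<kappa> * k - N - b - m) = 5 + \<kappa> * k - N - b - m * i" using mm by simp
  also have "2 * E (5 + \<kappa> * k - N - b - m * i) \<le> E (6 + \<kappa> * k - N - b - m * i)"
    using 2[of "5 + \<kappa> * k - N - b - m * i"] by (simp add: algebra_simps)
  finally show "\<bar>q * u - p\<bar> \<le> E (6 + \<kappa> * k - N - b - m * i)" .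
  have "q * (\<alpha> * u + \<beta>) - r = A1 * form A2 B2 C2 u - A2 * form A1 B1 C1 u"
    by (simp add: q_def r_def form_def algebra_simps)
  also have "\<bar>\<dots>\<bar> \<le> 2 * (E (m * i) * E (5 + \<kappa> * k - N - b - m))"
    using L F by (intro abs_cross_le) auto
  also have "\<dots> = 2 * E (m * i + (5 + \<kappa> * k - N - b - m))" unfolding E_mult ..
  also have "m * i + (5 + \<kappa> * k - N - b - m) = 5 + \<kappa> * k - N - b - m * j" using mm by simp
  also have "2 * E (5 + \<kappa> * k - N - b - m * j) \<le> E (6 + \<kappa> * k - N - b - m * j)"
    using 2[of "5 + \<kappa> * k - N - b - m * j"] by (simp add: algebra_simps)
  finally show "\<bar>q * (\<alpha> * u + \<beta>) - r\<bar> \<le> E (6 + \<kappa> * k - N - b - m * j)" .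
qed

text \<open>A denominator smaller by \<open>R powr k\<close> relaxes the tolerance of weight
  \<open>a\<close> by \<open>R powr (k * a)\<close>. Half of this exponent covers
  \<open>\<kappa> * k\<close>, since \<open>2 * \<kappa> \<le> a\<close>; the other half is at least
  10, since \<open>20 \<le> N * a\<close>, and covers the constants.\<close>

lemma near_point_of_bounds:
  assumes q: "0 < q" "real_of_int q \<le> E (1 + real m - k)" and k: "N \<le> k"
    and X: "\<bar>q * u - p\<bar> \<le> E (6 + \<kappa> * k - N - b - m * i)" "\<bar>q * (\<alpha> * u + \<beta>) - r\<bar> \<le> E (6 + \<kappa> * k - N - b - m * j)"
  shows "u \<in> near_point q p r"
proof -
  have *: "E (6 + \<kappa> * k - N - b - m * a) \<le> E (- N - b) * real_of_int q powr - a"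
    if a: "0 < a" "a \<le> 1" "2 * \<kappa> \<le> a" "20 \<le> N * a" for a :: real
  proof -
    have "N * a \<le> k * a" "k * (2 * \<kappa>) \<le> k * a" using a k by (intro mult_right_mono mult_left_mono; auto)+
    moreover have "\<kappa> * k = k * (2 * \<kappa>) / 2" by simp
    ultimately have "6 + \<kappa> * k + a \<le> k * a" using a by linarith
    then have "6 + \<kappa> * k - N - b - m * a \<le> (- N - b) + (1 + real m - k) * - a" by (simp add: algebra_simps)
    then have "E (6 + \<kappa> * k - N - b - m * a) \<le> E (- N - b) * E (1 + real m - k) powr - a"
      unfolding powr_powr E_mult by (rule E_mono)
    also have "\<dots> \<le> E (- N - b) * real_of_int q powr - a"
      using q a by (intro mult_left_mono powr_mono2') auto
    finally show ?thesis .
  qed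
  show ?thesis unfolding near_point_def
    using X *[of i] *[of j] ij \<kappa>_le N_ge by (auto intro: order_trans)
qed

text \<open>Proportional coefficient triples vanish at the same point of the line, so all these
  neighbourhoods have a common centre; the lower bound in \<open>line_class\<close> limits their
  length.\<close>

lemma near_line_parallel:
  fixes A1 B1 C1 A2 B2 C2 :: int
  assumes L: "line_class m k A1 B1" "line_class m k A2 B2"
    and par: "A1 * B2 = A2 * B1" "B1 * C2 = B2 * C1" "A2 * C1 = A1 * C2"
  shows "near_line m A2 B2 C2 \<subseteq> {x. \<bar>1 * x + (B1 * \<beta> + C1) / (A1 + B1 * \<alpha>)\<bar> \<le> E (3 - real N - b - m * (1 + \<mu>) + k)}"
proof
  fix x assume x: "x \<in> near_line m A2 B2 C2"
  have e: "E (m * \<mu> - k - 1) < \<bar>A1 + B1 * \<alpha>\<bar>" "E (m * \<mu> - k - 1) < \<bar>A2 + B2 * \<alpha>\<bar>"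
    using L by (auto simp: line_class_def)
  have ne: "A1 + B1 * \<alpha> \<noteq> 0" "A2 + B2 * \<alpha> \<noteq> 0" using e E_pos[of "m * \<mu> - k - 1"] by auto
  have par': "real_of_int A1 * B2 = real_of_int A2 * B1" "real_of_int B1 * C2 = real_of_int B2 * C1"
     "real_of_int A2 * C1 = real_of_int A1 * C2"
    using par by (metis of_int_mult)+
  have "(B1 * \<beta> + C1) * (A2 + B2 * \<alpha>) - (B2 * \<beta> + C2) * (A1 + B1 * \<alpha>)
     = \<beta> * (real_of_int A2 * B1 - real_of_int A1 * B2) + (real_of_int A2 * C1 - real_of_int A1 * C2)
       + \<alpha> * (real_of_int B2 * C1 - real_of_int B1 * C2)" by (simp add: algebra_simps)
  also have "\<dots> = 0" using par' by simp
  finally have "(B1 * \<beta> + C1) / (A1 + B1 * \<alpha>) = (B2 * \<beta> + C2) / (A2 + B2 * \<alpha>)"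
    using ne by (simp add: frac_eq_eq)
  moreover have "form A2 B2 C2 x = (A2 + B2 * \<alpha>) * (1 * x + (B2 * \<beta> + C2) / (A2 + B2 * \<alpha>))"
    using ne unfolding form_def distrib_left[of "A2 + B2 * \<alpha>" "1 * x"] by simp
  ultimately have "form A2 B2 C2 x = (A2 + B2 * \<alpha>) * (1 * x + (B1 * \<beta> + C1) / (A1 + B1 * \<alpha>))"
    by simp
  then have "\<bar>A2 + B2 * \<alpha>\<bar> * \<bar>1 * x + (B1 * \<beta> + C1) / (A1 + B1 * \<alpha>)\<bar> \<le> E (2 - real N - b - m)"
    using x by (simp add: near_line_def abs_mult)
  moreover have "E (m * \<mu> - k - 1) * \<bar>1 * x + (B1 * \<beta> + C1) / (A1 + B1 * \<alpha>)\<bar>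
      \<le> \<bar>A2 + B2 * \<alpha>\<bar> * \<bar>1 * x + (B1 * \<beta> + C1) / (A1 + B1 * \<alpha>)\<bar>"
    using e by (intro mult_right_mono) auto
  moreover have "E (2 - real N - b - m) = E (m * \<mu> - k - 1) * E (3 - real N - b - m * (1 + \<mu>) + k)"
    unfolding E_mult by (simp add: algebra_simps)
  ultimately have "E (m * \<mu> - k - 1) * \<bar>1 * x + (B1 * \<beta> + C1) / (A1 + B1 * \<alpha>)\<bar>
      \<le> E (m * \<mu> - k - 1) * E (3 - real N - b - m * (1 + \<mu>) + k)" by linarith
  then show "x \<in> {x. \<bar>1 * x + (B1 * \<beta> + C1) / (A1 + B1 * \<alpha>)\<bar> \<le> E (3 - real N - b - m * (1 + \<mu>) + k)}"
    using E_pos[of "m * \<mu> - k - 1"] by simp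
qed

text \<open>A genuine intersection would be a rational point of small height having \<open>u\<close>
  in its neighbourhood, but that obstacle has been avoided. Once the intersection determinant is 0,
  the other two minors are integers below 1 in absolute value.\<close>

lemma near_lines_dependent:
  assumes disj: "\<And>n'. E (- real n) \<le> E (6 - b) * E (- real n') \<Longrightarrow> {u..u + E (- real n)} \<inter> points n' = {}"
    and k: "N \<le> k" and n: "line_level m k = n"
    and L: "line_class m k A1 B1" "line_class m k A2 B2"
    and x: "x1 \<in> near_line m A1 B1 C1" "x2 \<in> near_line m A2 B2 C2" "x1 \<in> {u..u + E (- real n)}" "x2 \<in> {u..u + E (- real n)}"
  shows "A1 * B2 = A2 * B1 \<and> B1 * C2 = B2 * C1 \<and> A2 * C1 = A1 * C2"
proof -
  note nb = line_level_bounds[OF L(1), unfolded n]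
  have h: "E (- real n) \<le> E (- line_exponent m k)" using nb by (intro E_mono) simp
  have F: "\<bar>form A1 B1 C1 u\<bar> \<le> E (5 + \<kappa> * k - N - b - m)" "\<bar>form A2 B2 C2 u\<bar> \<le> E (5 + \<kappa> * k - N - b - m)"
    using line_class_near_form[OF L(1) x(1) _ _ h] line_class_near_form[OF L(2) x(2) _ _ h] x(3,4) by auto
  have no_point: False
    if q: "0 < q" "real_of_int q \<le> E (1 + real m - k)"
    and X: "\<bar>q * u - p\<bar> \<le> E (6 + \<kappa> * k - N - b - m * i)" "\<bar>q * (\<alpha> * u + \<beta>) - r\<bar> \<le> E (6 + \<kappa> * k - N - b - m * j)"
    for q p r :: int
  proof -
    have u: "u \<in> near_point q p r" by (rule near_point_of_bounds[OF q k X])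
    obtain m' where m': "point_class m' q" using point_class_ex[of q] q by auto
    have "E (real m' - 1) < E (1 + real m - k)" using m' q unfolding point_class_def by linarith
    then have "real (m' + k) < real (m + 2)" unfolding E_less_iff by simp
    then have "m' + k \<le> m + 1" unfolding of_nat_less_iff by simp
    then have "real (m' + k) \<le> real (m + 1)" by (simp only: of_nat_le_iff)
    then have "(m' + real k) * (1 + \<mu>) \<le> (real m + 1) * (1 + \<mu>)" using \<mu> by (intro mult_right_mono) auto
    moreover have "\<kappa> * k \<le> \<mu> * k" using \<kappa>_le \<mu> ij by (intro mult_right_mono) auto
    \<comment> \<open>The class drops from \<open>m\<close> to at most \<open>m + 1 - k\<close>,
      which lowers the point level by about \<open>k * (1 + \<mu>)\<close>, no less than the
      \<open>k * (1 + \<kappa>)\<close> in the line level; \<open>N\<close> pays for the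
      constants.\<close>
    ultimately have "- real n \<le> (6 - b) + - real (point_level m')"
      using nb point_level_bounds(2)[of m'] N_ge \<mu> unfolding line_exponent_def
      by (simp add: algebra_simps)
    then have "E (- real n) \<le> E (6 - b) * E (- real (point_level m'))" unfolding E_mult by (rule E_mono)
    then have "{u..u + E (- real n)} \<inter> points (point_level m') = {}" by (rule disj)
    moreover have "u \<in> points (point_level m')" using m' u unfolding points_def by blast
    moreover have "u \<in> {u..u + E (- real n)}" using E_pos[of "- real n"] by simp
    ultimately show False by blast
  qed
  let ?q = "A1 * B2 - A2 * B1" and ?p = "B1 * C2 - B2 * C1" and ?r = "A2 * C1 - A1 * C2"
  note bd = line_intersection_bounds[OF L F]
  have "?q = 0"
  proof (rule ccontr)
    assume "?q \<noteq> 0"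
    then consider "0 < ?q" | "0 < - ?q" by linarith
    then show False
    proof cases
      case 1
      show False by (rule no_point[OF 1 _ bd(2,3)]) (use bd(1) in linarith)
    next
      \<comment> \<open>Negating all three homogeneous coordinates gives a positive denominator for
        the same point.\<close>
      case 2
      show False
      proof (rule no_point[OF 2])
        show "real_of_int (- ?q) \<le> E (1 + real m - k)" using bd(1) by linarith
        show "\<bar>real_of_int (- ?q) * u - real_of_int (- ?p)\<bar> \<le> E (6 + \<kappa> * k - N - b - m * i)"
          using bd(2) by linarith
        show "\<bar>real_of_int (- ?q) * (\<alpha> * u + \<beta>) - real_of_int (- ?r)\<bar> \<le> E (6 + \<kappa> * k - N - b - m * j)"
          using bd(3) by (simp only: of_int_minus)
      qed
    qed
  qed
  \<comment> \<open>The class bound \<open>k \<le> 2 * m + 1\<close> gives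
    \<open>\<kappa> * k \<le> 2 * \<kappa> * m + \<kappa>\<close>, so \<open>m * a\<close> outweighs
    the growing part and \<open>N + b\<close> the rest.\<close>
  have small: "E (6 + \<kappa> * k - N - b - m * a) < 1" if "2 * \<kappa> \<le> a" for a :: real
  proof -
    have "\<kappa> * k \<le> \<kappa> * (2 * real m + 1)" using line_class_bound(2)[OF L(1)] \<kappa> by (intro mult_left_mono) auto
    moreover have "m * (2 * \<kappa>) \<le> m * a" using that by (intro mult_left_mono) auto
    ultimately have "6 + \<kappa> * k - N - b - m * a < 0" using \<kappa>_le N_ge b by (simp add: algebra_simps)
    then have "E (6 + \<kappa> * k - N - b - m * a) < E 0" by (simp only: E_less_iff)
    then show ?thesis using R_pos by simp
  qed
  have "\<bar>real_of_int ?p\<bar> < 1" "\<bar>real_of_int ?r\<bar> < 1"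
    using bd(2,3) small[OF \<kappa>_le(1)] small[OF \<kappa>_le(2)] unfolding \<open>?q = 0\<close> by auto
  then have "?p = 0" "?r = 0" by linarith+
  then show ?thesis using \<open>?q = 0\<close> by simp
qed

text \<open>Avoided point obstacles leave only one rational line up to proportionality at each
  \<open>k\<close>, hence one covering interval.\<close>

lemma lines_strategy:
  assumes disj: "\<And>n'. E (- real n) \<le> E (6 - b) * E (- real n') \<Longrightarrow> {u..u + E (- real n)} \<inter> points n' = {}"
    and k: "N \<le> k"
  shows "\<exists>v. lines n k \<inter> {u..u + E (- real n)} \<subseteq> {v..v + E (- \<kappa> * k / 2) * E (- real n)}"
proof (cases "lines n k \<inter> {u..u + E (- real n)} = {}")
  case False
  let ?J = "{u..u + E (- real n)}"
  obtain x1 m A1 B1 C1 where x1: "x1 \<in> ?J" and n: "line_level m k = n"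
    and L1: "line_class m k A1 B1" "x1 \<in> near_line m A1 B1 C1"
    using False unfolding lines_def by blast
  note nb = line_level_bounds[OF L1(1), unfolded n]
  let ?z = "(B1 * \<beta> + C1) / (A1 + B1 * \<alpha>)" and ?g = "E (3 - real N - b - m * (1 + \<mu>) + k)"
  have "lines n k \<inter> ?J \<subseteq> {x. \<bar>1 * x + ?z\<bar> \<le> ?g}"
  proof
    fix x assume x: "x \<in> lines n k \<inter> ?J"
    then obtain m' A2 B2 C2 where L2: "line_level m' k = n" "line_class m' k A2 B2" "x \<in> near_line m' A2 B2 C2"
      unfolding lines_def by blast
    have "m' = m" using line_level_inj[OF L2(2) L1(1)] L2(1) n by simp
    note L2 = L2[unfolded this]
    have "A1 * B2 = A2 * B1 \<and> B1 * C2 = B2 * C1 \<and> A2 * C1 = A1 * C2"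
      using x by (intro near_lines_dependent[OF disj k n L1(1) L2(2) L1(2) L2(3) x1]) auto
    then show "x \<in> {x. \<bar>1 * x + ?z\<bar> \<le> ?g}"
      using near_line_parallel[OF L1(1) L2(2), of C2 C1] L2(3) by blast
  qed
  moreover have "{x. \<bar>1 * x + ?z\<bar> \<le> ?g} \<subseteq> {- ?z / 1 - ?g / \<bar>1\<bar>..- ?z / 1 - ?g / \<bar>1\<bar> + 2 * ?g / \<bar>1\<bar>}"
    by (rule abs_affine_le_interval) simp
  \<comment> \<open>The level leaves a relative length of about
    \<open>R powr (1 - \<kappa> * k)\<close>; half of the exponent \<open>\<kappa> * k\<close> is
    given up to absorb the constants.\<close>
  moreover have "2 * ?g / \<bar>1\<bar> \<le> E (- \<kappa> * k / 2) * E (- real n)"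
  proof -
    have "\<kappa> * N \<le> \<kappa> * k" using k \<kappa> by (intro mult_left_mono) auto
    have "2 * ?g \<le> E (1 + (3 - real N - b - m * (1 + \<mu>) + k))" using R8 by (intro mult_E_le) auto
    also have "\<dots> \<le> E (- \<kappa> * k / 2 + - real n)"
      using nb \<open>\<kappa> * N \<le> \<kappa> * k\<close> N b unfolding line_exponent_def by (intro E_mono) (simp add: algebra_simps)
    finally show ?thesis by (simp add: E_mult)
  qed
  ultimately have "lines n k \<inter> ?J \<subseteq> {- ?z / 1 - ?g / \<bar>1\<bar>..- ?z / 1 - ?g / \<bar>1\<bar> + E (- \<kappa> * k / 2) * E (- real n)}"
    by fastforce
  then show ?thesis by blast
qed auto

section \<open>The combined strategy for one pair\<close>

text \<open>Index 0 carries the points and index \<open>k + 1\<close> the lines with parameter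
  \<open>N + k\<close>; each kind relies on the other having been avoided. The assumption on
  \<open>\<eta>\<close> is the exact sum of the weights, a single term plus a geometric
  series.\<close>

lemma avoidable_near_points:
  assumes \<gamma>: "0 < \<gamma>" and \<eta>: "E ((6 - b) * \<gamma>) + E (- \<kappa> * \<gamma> / 2 * N) / (1 - E (- \<kappa> * \<gamma> / 2)) \<le> \<eta>"
  shows "avoidable R \<gamma> \<eta> {x. \<exists>q p r. 1 \<le> q \<and> x \<in> near_point q p r}"
proof -
  define X where "X n l = (case l of 0 \<Rightarrow> points n | Suc k \<Rightarrow> lines n (N + k))" for n l
  define w where "w l = (case l of 0 \<Rightarrow> E (6 - b) | Suc k \<Rightarrow> E (- \<kappa> * real (N + k) / 2))" for l
  have w0: "w 0 powr \<gamma> = E ((6 - b) * \<gamma>)" by (simp add: w_def powr_powr)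
  have wS: "w (Suc k) powr \<gamma> = E (- \<kappa> * \<gamma> / 2 * N) * E (- \<kappa> * \<gamma> / 2) ^ k" for k
  proof -
    have "E (- \<kappa> * \<gamma> / 2) ^ k = E (- \<kappa> * \<gamma> / 2 * k)"
      using powr_powr[of R "- \<kappa> * \<gamma> / 2" k] powr_realpow[OF E_pos, of "- \<kappa> * \<gamma> / 2" k] by simp
    then have "E (- \<kappa> * \<gamma> / 2 * N) * E (- \<kappa> * \<gamma> / 2) ^ k = E (- \<kappa> * \<gamma> / 2 * N + - \<kappa> * \<gamma> / 2 * k)"
      by (simp only: E_mult)
    moreover have "- \<kappa> * \<gamma> / 2 * N + - \<kappa> * \<gamma> / 2 * k = - \<kappa> * real (N + k) / 2 * \<gamma>"
      by (simp add: field_simps)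
    ultimately show ?thesis by (simp only: w_def powr_powr nat.case)
  qed
  have "E (- \<kappa> * \<gamma> / 2) < E 0" unfolding E_less_iff using \<kappa> \<gamma> by simp
  then have "E (- \<kappa> * \<gamma> / 2) < 1" using R_pos by simp
  then have "(\<lambda>k. E (- \<kappa> * \<gamma> / 2 * N) * E (- \<kappa> * \<gamma> / 2) ^ k) sums (E (- \<kappa> * \<gamma> / 2 * N) * (1 / (1 - E (- \<kappa> * \<gamma> / 2))))"
    by (intro sums_mult geometric_sums) simp
  then have "(\<lambda>k. w (Suc k) powr \<gamma>) sums (E (- \<kappa> * \<gamma> / 2 * N) / (1 - E (- \<kappa> * \<gamma> / 2)))"
    unfolding wS by simp
  then have sums: "(\<lambda>l. w l powr \<gamma>) sums (E (- \<kappa> * \<gamma> / 2 * N) / (1 - E (- \<kappa> * \<gamma> / 2)) + E ((6 - b) * \<gamma>))"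
    using w0 by (subst (asm) sums_Suc_iff) simp
  have "strategy R \<gamma> \<eta> X w"
    unfolding strategy_def
  proof (intro conjI allI impI)
    fix l show "0 < w l" using R_pos by (simp add: w_def split: nat.split)
  next
    show "summable (\<lambda>l. w l powr \<gamma>)" using sums by (rule sums_summable)
    show "(\<Sum>l. w l powr \<gamma>) \<le> \<eta>" using sums_unique[OF sums] \<eta> by simp
  next
    fix n u l
    assume *: "\<forall>n' l. E (- real n) \<le> w l * E (- real n') \<longrightarrow> {u..u + E (- real n)} \<inter> X n' l = {}"
    have P: "{u..u + E (- real n)} \<inter> points n' = {}" if "E (- real n) \<le> E (6 - b) * E (- real n')" for n'
      using *[rule_format, of 0 n'] that by (simp add: X_def w_def)
    have L: "{u..u + E (- real n)} \<inter> lines n' k = {}"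
      if "N \<le> k" "E (- real n) \<le> E (- \<kappa> * k / 2) * E (- real n')" for n' k
      using *[rule_format, of "Suc (k - N)" n'] that by (simp add: X_def w_def)
    show "\<exists>v. X n l \<inter> {u..u + E (- real n)} \<subseteq> {v..v + w l * E (- real n)}"
    proof (cases l)
      case 0
      then show ?thesis using points_strategy[OF L] by (simp add: X_def w_def)
    next
      case (Suc k)
      then show ?thesis using lines_strategy[OF P, of "N + k"] by (simp add: X_def w_def)
    qed
  qed
  moreover have "{x. \<exists>q p r. 1 \<le> q \<and> x \<in> near_point q p r} \<subseteq> (\<Union>n l. X n l)"
  proof
    fix x assume "x \<in> {x. \<exists>q p r. 1 \<le> q \<and> x \<in> near_point q p r}"
    then obtain q p r where "1 \<le> q" "x \<in> near_point q p r" by blast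
    moreover obtain m where "point_class m q" using point_class_ex[OF \<open>1 \<le> q\<close>] by blast
    ultimately have "x \<in> X (point_level m) 0" by (auto simp: X_def points_def)
    then show "x \<in> (\<Union>n l. X n l)" by blast
  qed
  ultimately show ?thesis unfolding avoidable_def by blast
qed

end

section \<open>Choice of parameters from the Diophantine condition\<close>

lemma powr_minus_le_eventually:
  fixes R a t :: real
  assumes "1 < R" "0 < a" "0 < t"
  shows "\<exists>z0. \<forall>z\<ge>z0. R powr (- a * z) \<le> t"
proof (intro exI allI impI)
  fix z assume "log R (1 / t) / a \<le> z"
  then have "- a * z \<le> - log R (1 / t)" using assms by (simp add: pos_divide_le_eq mult.commute)
  then have "R powr (- a * z) \<le> R powr (- log R (1 / t))" using assms by (simp add: powr_mono)
  also have "\<dots> = t" using assms by (simp add: powr_minus)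
  finally show "R powr (- a * z) \<le> t" .
qed

text \<open>The condition on \<open>\<alpha>\<close> is applied with
  \<open>q = \<bar>B\<bar>\<close>. The exponent \<open>1 / min i j\<close> fits because
  \<open>\<bar>B\<bar>\<close> is at most a multiple of \<open>Q powr min i j\<close> whichever
  weight is smaller.\<close>

lemma diophantine_linear_form:
  fixes \<alpha> i j c0 \<epsilon> :: real
  assumes ij: "0 < i" "0 < j" "i + j = 1" and c0: "0 < c0" and \<epsilon>: "0 < \<epsilon>" "\<epsilon> \<le> 1"
    and dio: "\<And>q::nat. 1 \<le> q \<Longrightarrow> c0 \<le> real q powr (1 / min i j - \<epsilon>) * nint_dist (real q * \<alpha>)"
  shows "\<exists>c1>0. \<forall>Q (A::int) (B::int). 1 \<le> Q \<longrightarrow> (A, B) \<noteq> (0, 0) \<longrightarrow> \<bar>real_of_int A\<bar> \<le> Q powr i \<longrightarrow>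
           \<bar>real_of_int B\<bar> \<le> Q powr j \<longrightarrow> c1 * Q powr (- (1 - min i j * \<epsilon>)) \<le> \<bar>A + B * \<alpha>\<bar>"
proof -
  define \<nu> where "\<nu> = min i j"
  have \<nu>: "0 < \<nu>" "\<nu> \<le> 1 / 2" "\<nu> = i \<or> \<nu> = j" using ij by (auto simp: \<nu>_def)
  define \<theta> where "\<theta> = 1 / \<nu> - \<epsilon>"
  have "1 \<le> 1 / \<nu>" using \<nu> by (simp add: field_simps)
  then have \<theta>: "0 \<le> \<theta>" using \<epsilon> by (simp add: \<theta>_def)
  have \<nu>\<theta>: "\<nu> * \<theta> = 1 - \<nu> * \<epsilon>" using \<nu> by (simp add: \<theta>_def right_diff_distrib)
  have "\<alpha> \<noteq> 0"
  proof
    assume "\<alpha> = 0"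
    then show False using dio[of 1] c0 by (simp add: nint_dist_def)
  qed
  define K where "K = max 1 (2 / \<bar>\<alpha>\<bar>)"
  have K: "1 \<le> K" "2 / \<bar>\<alpha>\<bar> \<le> K" by (auto simp: K_def)
  define c1 where "c1 = min 1 (c0 * K powr - \<theta>)"
  have c1: "0 < c1" "c1 \<le> 1" "c1 \<le> c0 * K powr - \<theta>" using c0 K by (auto simp: c1_def)
  have "c1 * Q powr (- (1 - \<nu> * \<epsilon>)) \<le> \<bar>A + B * \<alpha>\<bar>"
    if Q: "1 \<le> Q" and ne: "(A, B) \<noteq> (0, 0)" and A: "\<bar>real_of_int A\<bar> \<le> Q powr i" and B: "\<bar>real_of_int B\<bar> \<le> Q powr j"
    for Q and A B :: int
  proof (cases "1 \<le> \<bar>A + B * \<alpha>\<bar>")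
    case True
    have "Q powr (- (1 - \<nu> * \<epsilon>)) \<le> Q powr 0"
      unfolding \<nu>\<theta>[symmetric] using Q \<nu> \<theta> by (intro powr_mono) auto
    then have "Q powr (- (1 - \<nu> * \<epsilon>)) \<le> 1" using Q by simp
    then have "c1 * Q powr (- (1 - \<nu> * \<epsilon>)) \<le> 1 * 1" using c1 by (intro mult_mono) auto
    then show ?thesis using True by simp
  next
    case False
    have "B \<noteq> 0"
    proof
      assume "B = 0"
      then have "1 \<le> \<bar>A\<bar>" using ne by simp
      then have "1 \<le> \<bar>real_of_int A\<bar>" by linarith
      then show False using False \<open>B = 0\<close> by simp
    qed
    \<comment> \<open>If \<open>i\<close> is the smaller weight, the bound comes from
      \<open>A\<close>: as \<open>\<bar>A + B * \<alpha>\<bar> < 1\<close>, the product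
      \<open>B * \<alpha>\<close> is at most \<open>\<bar>A\<bar> + 1\<close> in absolute
      value.\<close>
    have BQ: "\<bar>real_of_int B\<bar> \<le> K * Q powr \<nu>"
    proof -
      consider "\<nu> = j" | "\<nu> = i" using \<nu> by blast
      then show ?thesis
      proof cases
        case 1
        then have "1 * Q powr j \<le> K * Q powr \<nu>" using K by (intro mult_mono) auto
        then show ?thesis using B by simp
      next
        case 2
        have "Q powr 0 \<le> Q powr i" using Q ij by (intro powr_mono) auto
        then have "1 \<le> Q powr i" using Q by simp
        have "\<bar>B * \<alpha>\<bar> \<le> \<bar>real_of_int A\<bar> + 1" using False by linarith
        also have "\<dots> \<le> 2 * Q powr \<nu>" using A \<open>1 \<le> Q powr i\<close> 2 by simp
        finally have "\<bar>real_of_int B\<bar> \<le> 2 * Q powr \<nu> / \<bar>\<alpha>\<bar>"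
          using \<open>\<alpha> \<noteq> 0\<close> by (simp add: pos_le_divide_eq abs_mult)
        also have "\<dots> = (2 / \<bar>\<alpha>\<bar>) * Q powr \<nu>" by simp
        also have "\<dots> \<le> K * Q powr \<nu>" using K by (intro mult_right_mono) auto
        finally show ?thesis .
      qed
    qed
    define q where "q = nat \<bar>B\<bar>"
    have q: "1 \<le> q" "real q = \<bar>real_of_int B\<bar>" using \<open>B \<noteq> 0\<close> by (auto simp: q_def)
    have nd: "nint_dist (real q * \<alpha>) \<le> \<bar>A + B * \<alpha>\<bar>"
    proof (cases "B > 0")
      case True
      have "nint_dist (real q * \<alpha>) \<le> \<bar>real q * \<alpha> - real_of_int (- A)\<bar>"
        unfolding nint_dist_def by (rule round_diff_minimal)
      then show ?thesis using True q(2) by (simp add: add.commute)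
    next
      case False
      have "nint_dist (real q * \<alpha>) \<le> \<bar>real q * \<alpha> - real_of_int A\<bar>"
        unfolding nint_dist_def by (rule round_diff_minimal)
      moreover have "real q * \<alpha> - real_of_int A = - (A + B * \<alpha>)" using False q(2) by simp
      ultimately show ?thesis by (metis abs_minus_cancel)
    qed
    have "c1 * Q powr (- (1 - \<nu> * \<epsilon>)) \<le> c0 * K powr - \<theta> * Q powr (- (\<nu> * \<theta>))"
      unfolding \<nu>\<theta> using c1 by (intro mult_right_mono) auto
    also have "\<dots> = c0 * (K * Q powr \<nu>) powr - \<theta>"
      using K Q by (simp add: powr_mult powr_powr)
    also have "\<dots> \<le> c0 * real q powr - \<theta>"
      using c0 q BQ \<theta> by (intro mult_left_mono powr_mono2') auto
    also have "\<dots> \<le> (real q powr \<theta> * nint_dist (real q * \<alpha>)) * real q powr - \<theta>"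
      using dio[OF q(1)] by (intro mult_right_mono) (auto simp: \<theta>_def \<nu>_def)
    also have "\<dots> = nint_dist (real q * \<alpha>)" using q by (simp add: powr_minus)
    finally show ?thesis using nd by linarith
  qed
  then show ?thesis using c1 unfolding \<nu>_def by blast
qed

lemma (in line_pair) mem_Bad:
  assumes "\<nexists>q p r. 1 \<le> q \<and> x \<in> near_point q p r"
  shows "(x, \<alpha> * x + \<beta>) \<in> Bad i j"
proof -
  \<comment> \<open>In \<open>near_point\<close> the errors themselves are compared with
    \<open>c * q powr - i\<close> and \<open>c * q powr - j\<close>. Raising to the powers
    \<open>1 / i\<close> and \<open>1 / j\<close> changes \<open>c\<close>, so the constant for
    \<open>Bad\<close> is the smaller of the two powers.\<close>
  define c where "c = E (- N - b)"
  have c: "0 < c" using R_pos by (simp add: c_def)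
  have main: "(min (c powr (1 / i)) (c powr (1 / j))) / real q < max (pow_inv (nint_dist (real q * x)) i) (pow_inv (nint_dist (real q * (\<alpha> * x + \<beta>))) j)"
    if q: "1 \<le> q" for q :: nat
  proof -
    have *: "c powr (1 / a) / real q < pow_inv z a" if "0 < a" "c * real q powr - a < z" for a z
    proof -
      have "(c * real q powr - a) powr (1 / a) = c powr (1 / a) * real q powr (- a * (1 / a))"
        by (simp only: powr_mult powr_powr)
      also have "- a * (1 / a) = - 1" using that by simp
      finally have "c powr (1 / a) / real q = (c * real q powr - a) powr (1 / a)"
        using q by (simp add: powr_minus divide_inverse)
      also have "\<dots> < z powr (1 / a)" using that c by (intro powr_less_mono2) auto
      finally show ?thesis using that by (simp add: pow_inv_def)
    qed
    have "x \<notin> near_point (int q) (round (real q * x)) (round (real q * (\<alpha> * x + \<beta>)))"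
      using assms q by simp
    then have "c * real q powr - i < nint_dist (real q * x) \<or> c * real q powr - j < nint_dist (real q * (\<alpha> * x + \<beta>))"
      unfolding near_point_def nint_dist_def c_def by auto
    then have "c powr (1 / i) / real q < pow_inv (nint_dist (real q * x)) i \<or>
        c powr (1 / j) / real q < pow_inv (nint_dist (real q * (\<alpha> * x + \<beta>))) j"
      using * ij by blast
    moreover have "min (c powr (1 / i)) (c powr (1 / j)) / real q \<le> c powr (1 / i) / real q"
       "min (c powr (1 / i)) (c powr (1 / j)) / real q \<le> c powr (1 / j) / real q"
      by (auto intro: divide_right_mono)
    ultimately show ?thesis by linarith
  qed
  have "0 < min (c powr (1 / i)) (c powr (1 / j))" using c by simp
  with main show ?thesis unfolding Bad_def by blast
qed

text \<open>The parameters are fixed in the order \<open>R\<close>, \<open>\<eta>\<close>,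
  \<open>b\<close>, \<open>N\<close>: first \<open>b\<close> makes the points cheap, then
  \<open>N\<close> the lines. The threshold \<open>R0\<close> does not depend on
  \<open>\<eta>\<close>, so one \<open>R\<close> can serve all pairs with a budget chosen in terms
  of \<open>R\<close>.\<close>

lemma avoidable_not_Bad_pos:
  fixes \<alpha> \<beta> i j c0 \<epsilon> \<gamma> :: real
  assumes ij: "0 < i" "0 < j" "i + j = 1" and c0: "0 < c0" and \<epsilon>: "0 < \<epsilon>" "\<epsilon> \<le> 1"
    and dio: "\<And>q::nat. 1 \<le> q \<Longrightarrow> c0 \<le> real q powr (1 / min i j - \<epsilon>) * nint_dist (real q * \<alpha>)"
    and \<gamma>: "0 < \<gamma>"
  shows "\<exists>R0. \<forall>R\<ge>R0. \<forall>\<eta>>0. avoidable R \<gamma> \<eta> {x. (x, \<alpha> * x + \<beta>) \<notin> Bad i j}"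
proof -
  obtain c1 where c1: "0 < c1" and c1d: "\<And>Q (A::int) (B::int). 1 \<le> Q \<Longrightarrow> (A, B) \<noteq> (0, 0) \<Longrightarrow>
      \<bar>real_of_int A\<bar> \<le> Q powr i \<Longrightarrow> \<bar>real_of_int B\<bar> \<le> Q powr j \<Longrightarrow>
      c1 * Q powr (- (1 - min i j * \<epsilon>)) \<le> \<bar>A + B * \<alpha>\<bar>"
    using diophantine_linear_form[OF ij c0 \<epsilon> dio] by blast
  have "\<alpha> \<noteq> 0"
  proof
    assume "\<alpha> = 0"
    then show False using dio[of 1] c0 by (simp add: nint_dist_def)
  qed
  define \<nu> \<xi> \<kappa> where "\<nu> = min i j" and "\<xi> = min i j * \<epsilon>" and "\<kappa> = \<xi> / 2"
  have \<nu>: "0 < \<nu>" using ij by (simp add: \<nu>_def)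
  have \<xi>: "0 < \<xi>" "\<xi> \<le> \<nu>" using mult_left_mono[OF \<epsilon>(2), of \<nu>] \<nu> \<epsilon> by (auto simp: \<xi>_def \<nu>_def)
  have \<kappa>: "0 < \<kappa>" "2 * \<kappa> = \<xi>" using \<xi> by (auto simp: \<kappa>_def)
  define R0 where "R0 = Max {8, 2 + \<bar>\<alpha>\<bar>, 2 / \<bar>\<alpha>\<bar>, 1 / c1}"
  have "avoidable R \<gamma> \<eta> {x. (x, \<alpha> * x + \<beta>) \<notin> Bad i j}" if R: "R0 \<le> R" and \<eta>: "0 < \<eta>" for R \<eta>
  proof -
    have R': "8 \<le> R" "2 + \<bar>\<alpha>\<bar> \<le> R" "2 / \<bar>\<alpha>\<bar> \<le> R" "1 / c1 \<le> R"
      using R by (auto simp: R0_def)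
    obtain b0 where b0: "\<And>z. b0 \<le> z \<Longrightarrow> R powr (- \<gamma> * z) \<le> \<eta> / 2"
      using powr_minus_le_eventually[of R \<gamma> "\<eta> / 2"] R' \<gamma> \<eta> by auto
    define b where "b = max 8 (b0 + 6)"
    have b: "8 \<le> b" "R powr ((6 - b) * \<gamma>) \<le> \<eta> / 2"
      using b0[of "b - 6"] by (auto simp: b_def algebra_simps)
    define D where "D = 1 - R powr (- \<kappa> * \<gamma> / 2)"
    have "R powr (- \<kappa> * \<gamma> / 2) < R powr 0" using R' \<kappa> \<gamma> by (intro powr_less_mono) auto
    then have D: "0 < D" using R' by (simp add: D_def)
    obtain N0 where N0: "\<And>z. N0 \<le> z \<Longrightarrow> R powr (- (\<kappa> * \<gamma> / 2) * z) \<le> \<eta> / 2 * D"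
      using powr_minus_le_eventually[of R "\<kappa> * \<gamma> / 2" "\<eta> / 2 * D"] R' \<gamma> \<kappa> \<eta> D by auto
    define N where "N = nat \<lceil>Max {N0, 20 / \<nu>, 2 * b / \<kappa>}\<rceil>"
    have "Max {N0, 20 / \<nu>, 2 * b / \<kappa>} \<le> real N" unfolding N_def by linarith
    then have N: "N0 \<le> N" "20 / \<nu> \<le> N" "2 * b / \<kappa> \<le> N" by auto
    have "R powr (- \<kappa> * \<gamma> / 2 * N) / D \<le> \<eta> / 2"
      using N0[OF N(1)] D by (simp add: pos_divide_le_eq)
    then have sum: "R powr ((6 - b) * \<gamma>) + R powr (- \<kappa> * \<gamma> / 2 * N) / (1 - R powr (- \<kappa> * \<gamma> / 2)) \<le> \<eta>"
      using b(2) unfolding D_def by linarith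
    interpret line_pair R \<alpha> \<beta> i j \<kappa> \<xi> b N
    proof
      show "2 \<le> R * \<bar>\<alpha>\<bar>" using R'(3) \<open>\<alpha> \<noteq> 0\<close> by (simp add: pos_divide_le_eq)
      show "2 * \<kappa> \<le> min i j" using \<kappa> \<xi> by (simp add: \<nu>_def)
      show "20 \<le> real N * min i j" using N(2) \<nu> by (simp add: \<nu>_def pos_divide_le_eq)
      show "2 * b \<le> \<kappa> * real N" using N(3) \<kappa> by (simp add: pos_divide_le_eq mult.commute)
      fix m :: nat and A B :: int
      assume AB: "(A, B) \<noteq> (0, 0)" "\<bar>real_of_int A\<bar> \<le> R powr (m * i)" "\<bar>real_of_int B\<bar> \<le> R powr (m * j)"
      have "R powr 0 \<le> R powr m" using R' by (intro powr_mono) auto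
      then have "1 \<le> R powr m" using R' by simp
      moreover have "\<bar>real_of_int A\<bar> \<le> (R powr m) powr i" "\<bar>real_of_int B\<bar> \<le> (R powr m) powr j"
        using AB by (simp_all add: powr_powr)
      ultimately have "c1 * (R powr m) powr (- (1 - min i j * \<epsilon>)) \<le> \<bar>A + B * \<alpha>\<bar>"
        using AB(1) by (intro c1d) auto
      then have le: "c1 * R powr (- m * (1 - \<xi>)) \<le> \<bar>A + B * \<alpha>\<bar>"
        by (simp add: powr_powr \<xi>_def algebra_simps)
      have "R powr (- 1) \<le> c1" using R' c1 by (simp add: powr_minus field_simps)
      then have "R powr (- 1) * R powr (- m * (1 - \<xi>)) \<le> c1 * R powr (- m * (1 - \<xi>))"
        by (intro mult_right_mono) auto
      also note le
      finally have "R powr (- 1) * R powr (- m * (1 - \<xi>)) \<le> \<bar>A + B * \<alpha>\<bar>" .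
      moreover have "- 1 - m * (1 - \<xi>) = - 1 + - m * (1 - \<xi>)" by simp
      ultimately show "R powr (- 1 - m * (1 - \<xi>)) \<le> \<bar>A + B * \<alpha>\<bar>"
        by (simp only: powr_add)
    qed (use R' ij \<kappa> b in auto)
    have "avoidable R \<gamma> \<eta> {x. \<exists>q p r. 1 \<le> q \<and> x \<in> near_point q p r}"
      by (rule avoidable_near_points[OF \<gamma> sum])
    moreover have "{x. (x, \<alpha> * x + \<beta>) \<notin> Bad i j} \<subseteq> {x. \<exists>q p r. 1 \<le> q \<and> x \<in> near_point q p r}"
      using mem_Bad by blast
    ultimately show ?thesis unfolding avoidable_def by (meson order_trans)
  qed
  then show ?thesis by blast
qed

section \<open>Pairs with a vanishing weight\<close>

text \<open>Distinct fractions with denominators at most \<open>R powr m\<close> are at least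
  \<open>R powr (- 2 * m)\<close> apart. Hence at most one of them is close to the image of an
  interval of length \<open>R powr (- 2 * m - 2)\<close>.\<close>

lemma avoidable_not_bad_coordinate:
  fixes \<alpha> \<beta> \<gamma> :: real
  assumes "\<alpha> \<noteq> 0" "0 < \<gamma>"
  shows "\<exists>R0. \<forall>R\<ge>R0. \<forall>\<eta>>0. avoidable R \<gamma> \<eta>
     {x. \<not> (\<exists>c>0. \<forall>q::nat. 1 \<le> q \<longrightarrow> c / real q < nint_dist (real q * (\<alpha> * x + \<beta>)))}"
proof -
  define R0 where "R0 = Max {8, 2 + \<bar>\<alpha>\<bar>, 2 / \<bar>\<alpha>\<bar>}"
  have "avoidable R \<gamma> \<eta> {x. \<not> (\<exists>c>0. \<forall>q::nat. 1 \<le> q \<longrightarrow> c / real q < nint_dist (real q * (\<alpha> * x + \<beta>)))}"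
    if R: "R0 \<le> R" and \<eta>: "0 < \<eta>" for R \<eta>
  proof -
    have R': "8 \<le> R" "2 + \<bar>\<alpha>\<bar> \<le> R" "2 / \<bar>\<alpha>\<bar> \<le> R"
      using R by (auto simp: R0_def)
    then have R\<alpha>: "2 \<le> R * \<bar>\<alpha>\<bar>" using assms by (simp add: pos_divide_le_eq)
    have E_mono: "R powr x \<le> R powr y" if "x \<le> y" for x y using that R' by (simp add: powr_mono)
    have E_step: "k * R powr x \<le> R powr (1 + x)" if "k \<le> R" for k x
      using that R' by (simp add: powr_add mult_right_mono)
    define D where "D = 1 - R powr - \<gamma>"
    have "R powr - \<gamma> < R powr 0" using R' assms by (intro powr_less_mono) auto
    then have D: "0 < D" "R powr - \<gamma> < 1" using R' by (auto simp: D_def)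
    obtain b0 where b0: "\<And>z. b0 \<le> z \<Longrightarrow> R powr (- \<gamma> * z) \<le> \<eta> * D"
      using powr_minus_le_eventually[of R \<gamma> "\<eta> * D"] R' assms \<eta> D by auto
    define b where "b = max 8 (b0 + 5)"
    have b: "8 \<le> b" "R powr ((5 - b) * \<gamma>) \<le> \<eta> * D"
      using b0[of "b - 5"] by (auto simp: b_def algebra_simps)
    \<comment> \<open>Only index 0 will carry obstacles; the other weights decay geometrically to
      stay positive and summable.\<close>
    define w where "w l = R powr (5 - b - real l)" for l :: nat
    have w\<gamma>: "w l powr \<gamma> = R powr ((5 - b) * \<gamma>) * (R powr - \<gamma>) ^ l" for l
    proof -
      have "(R powr - \<gamma>) ^ l = R powr (- \<gamma> * l)"
        using R' powr_powr[of R "- \<gamma>" l] powr_realpow[of "R powr - \<gamma>" l] by simp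
      moreover have "(5 - b - real l) * \<gamma> = (5 - b) * \<gamma> + - \<gamma> * l" by (simp add: algebra_simps)
      ultimately show ?thesis by (simp only: w_def powr_powr powr_add)
    qed
    have "(\<lambda>l. R powr ((5 - b) * \<gamma>) * (R powr - \<gamma>) ^ l) sums (R powr ((5 - b) * \<gamma>) * (1 / D))"
      unfolding D_def using D by (intro sums_mult geometric_sums) simp
    then have sums: "(\<lambda>l. w l powr \<gamma>) sums (R powr ((5 - b) * \<gamma>) / D)" unfolding w\<gamma> by simp
    define near where "near q r = {x. \<bar>q * (\<alpha> * x + \<beta>) - r\<bar> \<le> R powr - b / q}" for q r :: int
    define cls where "cls m q \<longleftrightarrow> R powr (real m - 1) < q \<and> q \<le> R powr m" for m :: nat and q :: int
    define X where "X n l = (if l = 0 then {x. \<exists>m q r. 2 * m + 2 = n \<and> cls m q \<and> x \<in> near q r} else {})" for n l :: nat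
    have cls_pos: "0 < q" if "cls m q" for m q
    proof -
      have "0 < R powr (real m - 1)" using R' by simp
      then have "0 < real_of_int q" using that unfolding cls_def by linarith
      then show ?thesis by simp
    qed
    have near_bd: "\<bar>\<alpha> * x + (\<beta> - r / q)\<bar> \<le> R powr (2 - b - 2 * real m)" if "cls m q" "x \<in> near q r" for m q r x
    proof -
      have q: "0 < real_of_int q" "R powr (real m - 1) \<le> q" using cls_pos that by (auto simp: cls_def)
      have "\<bar>q * (\<alpha> * x + (\<beta> - r / q))\<bar> \<le> R powr - b / q"
        using that(2) q by (simp add: near_def algebra_simps)
      then have "q * \<bar>\<alpha> * x + (\<beta> - r / q)\<bar> \<le> R powr - b / q" using q by (simp add: abs_mult)
      then have "(real_of_int q * real_of_int q) * \<bar>\<alpha> * x + (\<beta> - r / q)\<bar> \<le> R powr - b"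
        using q by (simp add: pos_le_divide_eq ac_simps)
      moreover have "(R powr (real m - 1) * R powr (real m - 1)) * \<bar>\<alpha> * x + (\<beta> - r / q)\<bar> \<le> (real_of_int q * real_of_int q) * \<bar>\<alpha> * x + (\<beta> - r / q)\<bar>"
        using q by (intro mult_right_mono mult_mono) auto
      moreover have "R powr - b = (R powr (real m - 1) * R powr (real m - 1)) * R powr (2 - b - 2 * real m)"
        unfolding powr_add[symmetric] by simp
      ultimately have "(R powr (real m - 1) * R powr (real m - 1)) * \<bar>\<alpha> * x + (\<beta> - r / q)\<bar>
          \<le> (R powr (real m - 1) * R powr (real m - 1)) * R powr (2 - b - 2 * real m)" by linarith
      moreover have "0 < R powr (real m - 1) * R powr (real m - 1)" using R' by simp
      ultimately show ?thesis by (simp only: mult_le_cancel_left_pos)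
    qed
    have "strategy R \<gamma> \<eta> X w" unfolding strategy_def
    proof (intro conjI allI impI)
      fix l show "0 < w l" using R' by (simp add: w_def)
    next
      show "summable (\<lambda>l. w l powr \<gamma>)" using sums by (rule sums_summable)
      have "R powr ((5 - b) * \<gamma>) / D \<le> \<eta>" using b D by (simp add: pos_divide_le_eq)
      then show "(\<Sum>l. w l powr \<gamma>) \<le> \<eta>" using sums_unique[OF sums] by simp
    next
      fix n u l
      let ?J = "{u..u + R powr - real n}"
      show "\<exists>v. X n l \<inter> ?J \<subseteq> {v..v + w l * R powr - real n}"
      proof (cases "X n l \<inter> ?J = {}")
        case False
        then obtain x1 where "x1 \<in> X n l" and x1J: "x1 \<in> ?J" by blast
        then obtain m q1 r1 where l: "l = 0" and n: "2 * m + 2 = n" and q1: "cls m q1" and "x1 \<in> near q1 r1"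
          unfolding X_def by (auto split: if_splits)
        then have x1: "x1 \<in> near q1 r1" "x1 \<in> ?J" using x1J by auto
        let ?g = "R powr (2 - b - 2 * real m)"
        have "X n l \<inter> ?J \<subseteq> {x. \<bar>\<alpha> * x + (\<beta> - r1 / q1)\<bar> \<le> ?g}"
        proof
          fix x assume x: "x \<in> X n l \<inter> ?J"
          then obtain q r where q: "cls m q" and xq: "x \<in> near q r"
            using n l by (auto simp: X_def)
          have qp: "0 < real_of_int q" "0 < real_of_int q1" using cls_pos[OF q] cls_pos[OF q1] by auto
          have "\<bar>x - x1\<bar> \<le> R powr - real n" using x x1 by (auto simp: abs_le_iff)
          then have "\<bar>\<alpha>\<bar> * \<bar>x - x1\<bar> \<le> \<bar>\<alpha>\<bar> * R powr (- 2 - 2 * real m)"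
            using n by (intro mult_left_mono) (auto simp: algebra_simps)
          also have "\<dots> \<le> R powr (1 + (- 2 - 2 * real m))" by (rule E_step) (use R' in auto)
          finally have ax: "\<bar>\<alpha>\<bar> * \<bar>x - x1\<bar> \<le> R powr (- 1 - 2 * real m)" by simp
          have "r / q - r1 / q1 = (\<alpha> * x1 + (\<beta> - r1 / q1)) - (\<alpha> * x + (\<beta> - r / q)) + \<alpha> * (x - x1)"
            by (simp add: algebra_simps)
          then have "\<bar>r / q - r1 / q1\<bar> \<le> ?g + ?g + \<bar>\<alpha>\<bar> * \<bar>x - x1\<bar>"
            using near_bd[OF q xq] near_bd[OF q1 x1(1)] abs_mult[of \<alpha> "x - x1"] by linarith
          also have "\<dots> \<le> R powr (- 1 - 2 * real m) + R powr (- 1 - 2 * real m) + R powr (- 1 - 2 * real m)"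
            using b by (intro add_mono E_mono ax) auto
          also have "\<dots> = 3 * R powr (- 1 - 2 * real m)" by simp
          finally have "real_of_int q * real_of_int q1 * \<bar>r / q - r1 / q1\<bar> \<le> (R powr m * R powr m) * (3 * R powr (- 1 - 2 * real m))"
            using q q1 qp by (intro mult_mono) (auto simp: cls_def)
          also have "\<dots> = 3 * (R powr m * R powr m * R powr (- 1 - 2 * m))" by simp
          also have "\<dots> = 3 * R powr (- 1)" unfolding powr_add[symmetric] by simp
          also have "\<dots> < 1" using R' by (simp add: powr_minus field_simps)
          finally have "\<bar>real_of_int q * real_of_int q1 * (r / q - r1 / q1)\<bar> < 1" using qp by (simp add: abs_mult)
          moreover have "real_of_int q * real_of_int q1 * (r / q - r1 / q1) = real_of_int (r * q1 - r1 * q)"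
            using qp by (simp add: field_simps)
          ultimately have "r * q1 - r1 * q = 0" by linarith
          then have "real_of_int r * q1 = real_of_int r1 * q" by (metis eq_iff_diff_eq_0 of_int_mult)
          then have "r / q = r1 / q1" using qp by (simp add: frac_eq_eq)
          then show "x \<in> {x. \<bar>\<alpha> * x + (\<beta> - r1 / q1)\<bar> \<le> ?g}" using near_bd[OF q xq] by simp
        qed
        moreover note abs_affine_le_interval[OF assms(1), of "\<beta> - r1 / q1" ?g]
        moreover have "2 * ?g / \<bar>\<alpha>\<bar> \<le> w l * R powr - real n"
        proof -
          have "2 * ?g / \<bar>\<alpha>\<bar> \<le> (R * \<bar>\<alpha>\<bar>) * ?g / \<bar>\<alpha>\<bar>"
            using R\<alpha> by (intro divide_right_mono mult_right_mono) auto
          also have "\<dots> = R powr 1 * ?g" using assms R' by simp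
          also have "\<dots> = w l * R powr - real n" unfolding w_def l n[symmetric] powr_add[symmetric]
            by (simp add: algebra_simps)
          finally show ?thesis .
        qed
        then have "{v..v + 2 * ?g / \<bar>\<alpha>\<bar>} \<subseteq> {v..v + w l * R powr - real n}" for v by auto
        ultimately show ?thesis by blast
      qed auto
    qed
    moreover have "{x. \<not> (\<exists>c>0. \<forall>q::nat. 1 \<le> q \<longrightarrow> c / real q < nint_dist (real q * (\<alpha> * x + \<beta>)))} \<subseteq> (\<Union>n l. X n l)"
    proof
      fix x assume "x \<in> {x. \<not> (\<exists>c>0. \<forall>q::nat. 1 \<le> q \<longrightarrow> c / real q < nint_dist (real q * (\<alpha> * x + \<beta>)))}"
      moreover have "0 < R powr - b" using R' by simp
      ultimately have "\<exists>q::nat. 1 \<le> q \<and> \<not> R powr - b / real q < nint_dist (real q * (\<alpha> * x + \<beta>))"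
        by blast
      then obtain q :: nat where q: "1 \<le> q" "nint_dist (real q * (\<alpha> * x + \<beta>)) \<le> R powr - b / real q"
        by (auto simp: not_less)
      define y where "y = log R q"
      have y: "0 \<le> y" "R powr y = q" using q R' by (auto simp: y_def)
      define m where "m = nat \<lceil>y\<rceil>"
      have "real m - 1 < y" "y \<le> m" using y(1) unfolding m_def by linarith+
      then have "R powr (real m - 1) < R powr y" "R powr y \<le> R powr m" using R' by auto
      then have "cls m (int q)" unfolding cls_def using y(2) by simp
      moreover have "x \<in> near (int q) (round (real q * (\<alpha> * x + \<beta>)))"
        using q(2) by (simp add: near_def nint_dist_def)
      ultimately have "x \<in> X (2 * m + 2) 0" unfolding X_def by auto
      then show "x \<in> (\<Union>n l. X n l)" by blast
    qed
    ultimately show ?thesis unfolding avoidable_def by blast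
  qed
  then show ?thesis by blast
qed

section \<open>The dimension\<close>

lemma nint_dist_multiple:
  assumes "nint_dist z = 0"
  shows "nint_dist (real n * z) = 0"
proof -
  have z: "z = real_of_int (round z)" using assms by (simp add: nint_dist_def)
  have "real n * z = real_of_int (int n * round z)" by (subst z) simp
  then show ?thesis unfolding nint_dist_def by (simp only: round_of_int)
qed

text \<open>If \<open>q * \<alpha>\<close> were an integer for one \<open>q \<ge> 1\<close>, so
  would be all multiples, including those beyond the threshold of the liminf. Thus the finitely many
  small \<open>q\<close> give positive values and a minimum can be taken.\<close>

lemma liminf_pos_imp_bound:
  fixes \<alpha> e :: real
  assumes "0 < liminf (\<lambda>q::nat. ereal (real q powr e * nint_dist (real q * \<alpha>)))"
  shows "\<exists>c>0. \<forall>q\<ge>1. c \<le> real q powr e * nint_dist (real q * \<alpha>)"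
proof -
  let ?f = "\<lambda>q::nat. real q powr e * nint_dist (real q * \<alpha>)"
  obtain c0 where c0: "0 < ereal c0" "ereal c0 < liminf (\<lambda>q. ereal (?f q))"
    using ereal_dense2[OF assms] by auto
  obtain q0 where q0: "\<And>q. q0 \<le> q \<Longrightarrow> ereal c0 < ereal (?f q)"
    using less_LiminfD[OF c0(2)] unfolding eventually_sequentially by blast
  have large: "c0 \<le> ?f q" if "q0 \<le> q" for q using q0[OF that] by simp
  have pos: "0 < ?f q" if q: "1 \<le> q" for q
  proof (rule ccontr)
    assume "\<not> 0 < ?f q"
    then have "nint_dist (real q * \<alpha>) = 0"
      using q by (auto simp: nint_dist_def zero_less_mult_iff)
    then have "nint_dist (real (Suc q0) * (real q * \<alpha>)) = 0" by (rule nint_dist_multiple)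
    then have "?f (Suc q0 * q) = 0" by (simp only: of_nat_mult mult.assoc mult_zero_right)
    moreover have "c0 \<le> ?f (Suc q0 * q)" using q by (intro large) (cases q, auto)
    ultimately have "c0 \<le> 0" by (simp only:)
    then show False using c0(1) by simp
  qed
  define c where "c = Min (insert c0 (?f ` {1..q0}))"
  have "0 < c" unfolding c_def using c0(1) pos by auto
  moreover have "c \<le> ?f q" if q: "1 \<le> q" for q
  proof (cases "q0 \<le> q")
    case True
    have "c \<le> c0" unfolding c_def by simp
    then show ?thesis using large[OF True] by simp
  next
    case False
    then show ?thesis unfolding c_def using q by (intro Min_le) auto
  qed
  ultimately show ?thesis by blast
qed

lemma slope_nonzero:
  assumes "c > 0" "\<And>q::nat. 1 \<le> q \<Longrightarrow> c \<le> real q powr e * nint_dist (real q * \<alpha>)"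
  shows "\<alpha> \<noteq> 0"
  using assms(2)[of 1] assms(1) by (auto simp: nint_dist_def)

text \<open>Each minimum is at most \<open>\<sigma>\<close>, so for positive weights
  \<open>1 / min (i t) (j t)\<close> is at least \<open>1 / \<sigma>\<close> and the condition
  passes to the single pair. With a zero weight, the convention in \<open>pow_inv\<close> leaves a
  condition on one coordinate.\<close>

lemma avoidable_not_Bad:
  fixes i j :: "nat \<Rightarrow> real" and \<alpha> \<beta> \<gamma> :: real
  assumes ij: "\<forall>t\<in>{1..d}. 0 \<le> i t \<and> i t \<le> 1 \<and> 0 \<le> j t \<and> j t \<le> 1 \<and> i t + j t = 1"
    and slope: "let \<sigma> = Max ((\<lambda>t. min (i t) (j t)) ` {1..d}) in
         (if \<sigma> = 0 then \<alpha> \<notin> \<rat>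
          else (\<exists>\<epsilon>>0. liminf (\<lambda>q::nat. ereal (real q powr (1 / \<sigma> - \<epsilon>) * nint_dist (real q * \<alpha>))) > 0))"
    and t: "t \<in> {1..d}" and \<gamma>: "0 < \<gamma>"
  shows "\<exists>R0. \<forall>R\<ge>R0. \<forall>\<eta>>0. avoidable R \<gamma> \<eta> {x. (x, \<alpha> * x + \<beta>) \<notin> Bad (i t) (j t)}"
proof -
  define \<sigma> where "\<sigma> = Max ((\<lambda>t. min (i t) (j t)) ` {1..d})"
  have t\<sigma>: "min (i t) (j t) \<le> \<sigma>" unfolding \<sigma>_def using t by (intro Max_ge) auto
  have ijt: "0 \<le> i t" "0 \<le> j t" "i t + j t = 1" using ij t by auto
  have slope': "if \<sigma> = 0 then \<alpha> \<notin> \<rat>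
      else (\<exists>\<epsilon>>0. liminf (\<lambda>q::nat. ereal (real q powr (1 / \<sigma> - \<epsilon>) * nint_dist (real q * \<alpha>))) > 0)"
    using slope unfolding Let_def \<sigma>_def .
  have cases: "\<sigma> = 0 \<and> \<alpha> \<notin> \<rat> \<or>
      (\<exists>\<epsilon>>0. \<exists>c>0. \<forall>q\<ge>1. c \<le> real q powr (1 / \<sigma> - \<epsilon>) * nint_dist (real q * \<alpha>))"
  proof (cases "\<sigma> = 0")
    case False
    then obtain \<epsilon> where "0 < \<epsilon>" "0 < liminf (\<lambda>q::nat. ereal (real q powr (1 / \<sigma> - \<epsilon>) * nint_dist (real q * \<alpha>)))"
      using slope' by auto
    then show ?thesis using liminf_pos_imp_bound by blast
  qed (use slope' in simp)
  then have \<alpha>: "\<alpha> \<noteq> 0" using slope_nonzero by (metis Rats_0)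
  show ?thesis
  proof (cases "0 < i t \<and> 0 < j t")
    case True
    then have pos: "0 < min (i t) (j t)" by simp
    then obtain \<epsilon> c where \<epsilon>: "0 < \<epsilon>" and c: "0 < c"
      and dio: "\<And>q::nat. 1 \<le> q \<Longrightarrow> c \<le> real q powr (1 / \<sigma> - \<epsilon>) * nint_dist (real q * \<alpha>)"
      using cases t\<sigma> by auto
    have "c \<le> real q powr (1 / min (i t) (j t) - min \<epsilon> 1) * nint_dist (real q * \<alpha>)" if q: "1 \<le> q" for q :: nat
    proof -
      have "1 / \<sigma> \<le> 1 / min (i t) (j t)" using pos t\<sigma> by (intro divide_left_mono) auto
      then have "real q powr (1 / \<sigma> - \<epsilon>) \<le> real q powr (1 / min (i t) (j t) - min \<epsilon> 1)"
        using q by (intro powr_mono) auto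
      then have "real q powr (1 / \<sigma> - \<epsilon>) * nint_dist (real q * \<alpha>) \<le>
          real q powr (1 / min (i t) (j t) - min \<epsilon> 1) * nint_dist (real q * \<alpha>)"
        by (rule mult_right_mono) (simp add: nint_dist_def)
      with dio[OF q] show ?thesis by linarith
    qed
    then show ?thesis using True ijt c \<epsilon> \<gamma> by (intro avoidable_not_Bad_pos[where \<epsilon> = "min \<epsilon> 1" and ?c0.0 = c]) auto
  next
    case False
    have n0: "0 \<le> nint_dist z" for z by (simp add: nint_dist_def)
    have mono: "\<exists>R0. \<forall>R\<ge>R0. \<forall>\<eta>>0. avoidable R \<gamma> \<eta> {x. (x, \<alpha> * x + \<beta>) \<notin> Bad (i t) (j t)}"
      if "a \<noteq> 0" and "\<And>x. \<exists>c>0. \<forall>q::nat. 1 \<le> q \<longrightarrow> c / real q < nint_dist (real q * (a * x + b)) \<Longrightarrow>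
           (x, \<alpha> * x + \<beta>) \<in> Bad (i t) (j t)" for a b
    proof -
      have "{x. (x, \<alpha> * x + \<beta>) \<notin> Bad (i t) (j t)} \<subseteq>
         {x. \<not> (\<exists>c>0. \<forall>q::nat. 1 \<le> q \<longrightarrow> c / real q < nint_dist (real q * (a * x + b)))}" using that(2) by blast
      then show ?thesis using avoidable_not_bad_coordinate[OF that(1) \<gamma>, of b]
        unfolding avoidable_def by (meson order_trans)
    qed
    consider "i t = 0" "j t = 1" | "i t = 1" "j t = 0" using False ijt by fastforce
    then show ?thesis
    proof cases
      case 1
      then show ?thesis using n0 \<alpha> by (intro mono[of \<alpha> \<beta>]) (auto simp: Bad_def pow_inv_def)
    next
      \<comment> \<open>The remaining coordinate is \<open>x\<close> itself, the affine map with
        slope 1 and intercept 0.\<close>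
      case 2
      then show ?thesis using n0 by (intro mono[of 1 0]) (auto simp: Bad_def pow_inv_def)
    qed
  qed
qed

lemma hausdorff_measure_Bad_line_nonzero:
  fixes i j :: "nat \<Rightarrow> real" and \<alpha> \<beta> s :: real
  assumes d: "d \<ge> 1"
    and ij: "\<forall>t\<in>{1..d}. 0 \<le> i t \<and> i t \<le> 1 \<and> 0 \<le> j t \<and> j t \<le> 1 \<and> i t + j t = 1"
    and slope: "let \<sigma> = Max ((\<lambda>t. min (i t) (j t)) ` {1..d}) in
         (if \<sigma> = 0 then \<alpha> \<notin> \<rat>
          else (\<exists>\<epsilon>>0. liminf (\<lambda>q::nat. ereal (real q powr (1 / \<sigma> - \<epsilon>) * nint_dist (real q * \<alpha>))) > 0))"
    and s: "0 < s" "s < 1"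
  shows "hausdorff_measure s ((\<Inter>t\<in>{1..d}. Bad (i t) (j t)) \<inter> line \<alpha> \<beta>) \<noteq> 0"
proof
  let ?B = "(\<Inter>t\<in>{1..d}. Bad (i t) (j t)) \<inter> line \<alpha> \<beta>"
  let ?S = "\<lambda>t. {x. (x, \<alpha> * x + \<beta>) \<notin> Bad (i t) (j t)}"
  assume null: "hausdorff_measure s ?B = 0"
  obtain R0 where R0: "\<And>t R \<eta>. t \<in> {1..d} \<Longrightarrow> R0 t \<le> R \<Longrightarrow> 0 < \<eta> \<Longrightarrow> avoidable R s \<eta> (?S t)"
    using avoidable_not_Bad[OF ij slope _ s(1), of _ \<beta>] by metis
  \<comment> \<open>The entry \<open>(9 / 2) powr (1 / (1 - s))\<close> secures
    \<open>9 / 2 \<le> R powr (1 - s)\<close>, the growth condition of the game; the others are the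
    thresholds of the \<open>d\<close> pairs.\<close>
  define R where "R = nat \<lceil>Max (insert 2 (insert ((9 / 2) powr (1 / (1 - s))) (R0 ` {1..d})))\<rceil>"
  have "Max (insert 2 (insert ((9 / 2) powr (1 / (1 - s))) (R0 ` {1..d}))) \<le> real R"
    unfolding R_def by linarith
  then have R: "2 \<le> R" "(9 / 2) powr (1 / (1 - s)) \<le> real R" "\<And>t. t \<in> {1..d} \<Longrightarrow> R0 t \<le> real R"
    by auto
  have "((9 / 2) powr (1 / (1 - s))) powr (1 - s) \<le> real R powr (1 - s)"
    using R(2) s by (intro powr_mono2) auto
  then have "9 / 2 \<le> real R powr (1 - s)" using s by (simp add: powr_powr)
  then have "9 / 2 * real R powr s \<le> real R powr (1 - s) * real R powr s" by (rule mult_right_mono) simp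
  also have "\<dots> = real R" using R(1) by (simp add: powr_add[symmetric])
  finally have Rs: "9 / 4 * real R powr s \<le> real R / 2" by simp
  \<comment> \<open>The \<open>d\<close> pairs share one \<open>\<eta>\<close> equally and the
    Hausdorff cover gets another, together the \<open>1 / (8 * R)\<close> allowed in the
    game.\<close>
  define \<eta> where "\<eta> = 1 / (16 * real R)"
  have \<eta>: "0 < \<eta>" using R(1) by (simp add: \<eta>_def)
  have "avoidable R s (real (card {1..d}) * (\<eta> / d)) (\<Union>t\<in>{1..d}. ?S t)"
    using d R \<eta> R0 by (intro avoidable_UN) auto
  moreover have "avoidable R s \<eta> (fst ` ?B)"
    using R(1) by (intro avoidable_hausdorff_null[OF _ s(1) \<eta> null]) simp
  ultimately have "avoidable R s (real (card {1..d}) * (\<eta> / d) + \<eta>) ((\<Union>t\<in>{1..d}. ?S t) \<union> fst ` ?B)"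
    by (rule avoidable_Un)
  also have "real (card {1..d}) * (\<eta> / d) + \<eta> = 1 / (8 * real R)"
    using d R(1) by (simp add: \<eta>_def field_simps)
  finally obtain x where x: "x \<notin> (\<Union>t\<in>{1..d}. ?S t) \<union> fst ` ?B"
    using avoidable_point[OF s R(1) Rs] by blast
  then have "(x, \<alpha> * x + \<beta>) \<in> ?B" by (auto simp: line_def)
  then have "x \<in> fst ` ?B" by force
  with x show False by blast
qed

theorem theorem2:
  fixes d :: nat and i j :: "nat \<Rightarrow> real" and \<alpha> \<beta> :: real
  assumes "d \<ge> 1"
    and "\<forall>t\<in>{1..d}. 0 \<le> i t \<and> i t \<le> 1 \<and> 0 \<le> j t \<and> j t \<le> 1 \<and> i t + j t = 1"
    and "let \<sigma> = Max ((\<lambda>t. min (i t) (j t)) ` {1..d}) in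
         (if \<sigma> = 0 then \<alpha> \<notin> \<rat>
          else (\<exists>\<epsilon>>0. liminf (\<lambda>q::nat. ereal (real q powr (1 / \<sigma> - \<epsilon>) * nint_dist (real q * \<alpha>))) > 0))"
  shows "hausdorff_dim ((\<Inter>t\<in>{1..d}. Bad (i t) (j t)) \<inter> line \<alpha> \<beta>) = 1"
proof -
  let ?D = "{s. s > 0 \<and> hausdorff_measure s ((\<Inter>t\<in>{1..d}. Bad (i t) (j t)) \<inter> line \<alpha> \<beta>) = 0}"
  have up: "s \<in> ?D" if "1 < s" for s
    using that hausdorff_measure_line_eq_0[OF that, of _ \<alpha> \<beta>] by auto
  have low: "1 \<le> s" if "s \<in> ?D" for s
    using that hausdorff_measure_Bad_line_nonzero[OF assms, of s] by force
  \<comment> \<open>Measure zero is available for exponents strictly above 1, so 1 is approached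
    from above.\<close>
  have "Inf ?D \<le> 1 + e" if "0 < e" for e
  proof (rule cInf_lower)
    show "1 + e \<in> ?D" by (rule up) (use that in simp)
    show "bdd_below ?D" by (rule bdd_belowI[of _ 1]) (rule low)
  qed
  then have "Inf ?D \<le> 1" by (rule field_le_epsilon)
  moreover have "1 \<le> Inf ?D"
  proof (rule cInf_greatest)
    have "2 \<in> ?D" by (rule up) simp
    then show "?D \<noteq> {}" by (metis empty_iff)
  qed (rule low)
  ultimately show ?thesis unfolding hausdorff_dim_def by linarith
qed

end
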